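(* Let $\hat U$ be the solution of the integral equation (IE), let $q_0>0$ and $\alpha>0$, and let $\epsilon_1,\epsilon,b$ be the functionals of the restriction of $\hat U$ to $(0,q_0]$ and of the data defined in the context. If $$\alpha^{1/2+1/(2n)}>\epsilon_1+2\sqrt{\epsilon b},$$ then $$\int_0^\infty\|\hat U(\cdot,q)\|_{l^1}e^{-\alpha q}\,dq<\infty.$$
   Context: $n\ge1$ is an integer, $\nu>0$. $v_0,f:\mathbb{T}^3[0,2\pi]\to\mathbb{R}^3$ are divergence-free ($f$ time-independent), with Fourier coefficients $\hat v_0,\hat f\in l^1(\mathbb{Z}^3)$ and $\hat v_0(0)=0=\hat f(0)$. $\|\hat g\|_{l^1}=\sum_{k\in\mathbb{Z}^3}|\hat g(k)|$. All functions of $k$ below vanish at $k=0$. Notation: $P_k=1-\frac{k(k\cdot)}{|k|^2}$; $\hat *$ is Fourier (discrete) convolution in $k$; Laplace convolution is $(a*b)(q)=\int_0^q a(q')b(q-q')dq'$; $\overset{*}{*}$ denotes simultaneous Fourier and Laplace convolution; repeated $j$ is summed over $1,2,3$. (IE): $\hat U(k,q)=-ik_j\int_0^q\mathcal G(q,q';k)\hat H_j(k,q')dq'+\hat U^{(0)}(k,q)$, where $\hat H_j=P_k[\hat v_{0,j}\mathbin{\hat *}\hat U+\hat U_j\mathbin{\hat *}\hat v_0+\hat U_j\overset{*}{*}\hat U]$. The solution $\hat U$ of (IE) is the one with $\int_0^\infty e^{-\alpha' q}\|\hat U(\cdot,q)\|_{l^1}dq<\infty$ for $\alpha'$ large enough.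 Put $\hat v_1(k)=-\nu|k|^2\hat v_0-ik_jP_k[\hat v_{0,j}\mathbin{\hat *}\hat v_0]+\hat f(k)$. For $n=1$, with $z=2|k|\sqrt{\nu q}$, $z'=2|k|\sqrt{\nu q'}$ and $J_1,Y_1$ Bessel functions, $\mathcal G(q,q';k)=\frac{\pi z'}{z}(J_1(z)Y_1(z')-J_1(z')Y_1(z))$, $\hat U^{(0)}(k,q)=2\hat v_1(k)J_1(z)/z$. For $n\ge2$, with $\gamma=q'/q$, $\mu=\nu|k|^2q^{1/n}(1-s\gamma^{1/n})(1-s^{-n})^{1/n}$, $$\mathcal G(q,q';k)=\frac{\gamma^{1/n}}{\nu^{1/2}|k|q^{1-1/(2n)}}\int_1^{\gamma^{-1/n}}(1-s^{-n})^{1/(2n)-1}(1-s\gamma^{1/n})^{-1/2}\mu^{1/2}F(\mu)\,ds,$$ $$\hat U^{(0)}(k,q)=\frac{\hat v_1(k)}{\nu|k|^2q}G(\nu|k|^2q^{1/n}),$$ $$F(\mu)=\frac1{2\pi i}\int_C\zeta^{-1/n}e^{\zeta-\mu\zeta^{-1/n}}d\zeta,\qquad G(\mu)=-\frac1{2\pi i}\int_Ce^{\zeta-\mu\zeta^{-1/n}}d\zeta,$$ where $C$ runs from $\infty e^{-i\pi}$ to $\infty e^{i\pi}$ turning around the origin counterclockwise. Definitions for this statement: $\hat U^{(a)}(k,q)=\hat U(k,q)$ for $q\in(0,q_0]$ and $\hat U^{(a)}(k,q)=0$ otherwise; $$\hat H^{(a)}_j=P_k\big[\hat v_{0,j}\mathbin{\hat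 *}\hat U^{(a)}+\hat U^{(a)}_j\mathbin{\hat *}\hat v_0+\hat U^{(a)}_j\overset{*}{*}\hat U^{(a)}\big],$$ $$\hat U^{(s)}(k,q)=-ik_j\int_0^{\min\{q,2q_0\}}\mathcal G(q,q';k)\hat H^{(a)}_j(k,q')\,dq'+\hat U^{(0)}(k,q);$$ $$B_0(k)=\sup_{q_0\le q'\le q}\big\{(q-q')^{1/2-1/(2n)}|\mathcal G(q,q';k)|\big\},\qquad B_1=4\sup_{k\in\mathbb{Z}^3}\{|k|B_0(k)\}\,\|\hat v_0\|_{l^1},$$ $$B_2(q)=4\sup_{k\in\mathbb{Z}^3}\{|k|B_0(k)\}\,\|\hat U^{(a)}(\cdot,q)\|_{l^1},\qquad B_3=2\sup_{k\in\mathbb{Z}^3}\{|k|B_0(k)\}$$ (the term $|k|B_0(k)$ at $k=0$ is taken to be $0$); $$b=\alpha^{1/2+1/(2n)}\int_{q_0}^\infty e^{-\alpha q}\|\hat U^{(s)}(\cdot,q)\|_{l^1}dq,$$ $$\epsilon_1=\Gamma\Big(\tfrac12+\tfrac1{2n}\Big)\Big[B_1+\int_0^{q_0}e^{-\alpha q'}B_2(q')dq'\Big],\qquad \epsilon=\Gamma\Big(\tfrac12+\tfrac1{2n}\Big)B_3.$$ *)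

theory Defs
  imports "HOL-Complex_Analysis.Complex_Analysis"
begin

text \<open>A function on the torus is a function on \<open>\<real>\<^sup>3\<close> with period \<open>2\<pi>\<close> in each variable.\<close>

definition torus_periodic :: "(real^3 \<Rightarrow> 'a) \<Rightarrow> bool" where
  "torus_periodic g \<longleftrightarrow> (\<forall>x j. g (x + axis j (2 * pi)) = g x)"

definition torus_cell :: "(real^3) set" where
  "torus_cell = cbox 0 (\<chi> j. 2 * pi)"

text \<open>A field with absolutely summable Fourier coefficients need not be differentiable, so the
  divergence is taken in the weak sense, against periodic \<open>C\<^sup>1\<close> test functions \<open>\<phi>\<close> with
  gradient \<open>g\<close>.\<close>

definition divergence_free :: "(real^3 \<Rightarrow> real^3) \<Rightarrow> bool" where
  "divergence_free v \<longleftrightarrow>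
     (\<forall>(\<phi> :: real^3 \<Rightarrow> real) (g :: real^3 \<Rightarrow> real^3).
        torus_periodic \<phi> \<and> continuous_on UNIV g \<and>
        (\<forall>x. (\<phi> has_derivative (\<lambda>h. g x \<bullet> h)) (at x)) \<longrightarrow>
        (LINT x:torus_cell|lborel. v x \<bullet> g x) = 0)"

definition wavevec :: "int^3 \<Rightarrow> real^3" where
  "wavevec k = (\<chi> j. of_int (k $ j))"

text \<open>Normalised so that \<open>v(x) = \<Sum>k. fourier v k * exp(i k \<cdot> x)\<close>, which is the normalisation for
  which products become discrete convolutions without a constant.\<close>

definition fourier :: "(real^3 \<Rightarrow> real^3) \<Rightarrow> int^3 \<Rightarrow> complex^3" where
  "fourier v k = (\<chi> j. (LINT x:torus_cell|lborel.
      exp (- \<i> * of_real (wavevec k \<bullet> x)) * of_real (v x $ j)) / of_real ((2 * pi) ^ 3))"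

definition l1norm :: "(int^3 \<Rightarrow> complex^3) \<Rightarrow> ennreal" where
  "l1norm g = (\<integral>\<^sup>+k. ennreal (norm (g k)) \<partial>count_space UNIV)"

definition admissible_field :: "(real^3 \<Rightarrow> real^3) \<Rightarrow> bool" where
  "admissible_field v \<longleftrightarrow>
     torus_periodic v \<and> set_integrable lborel torus_cell v \<and> divergence_free v \<and>
     l1norm (fourier v) < \<infinity> \<and> fourier v 0 = 0"

definition fconv :: "(int^3 \<Rightarrow> complex) \<Rightarrow> (int^3 \<Rightarrow> complex^3) \<Rightarrow> int^3 \<Rightarrow> complex^3" where
  "fconv a b k = (\<Sum>\<^sub>\<infinity>k'. a k' *s b (k - k'))"

definition lconv :: "(real \<Rightarrow> complex) \<Rightarrow> (real \<Rightarrow> complex^3) \<Rightarrow> real \<Rightarrow> complex^3" where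
  "lconv a b q = (LINT q':{0..q}|lborel. a q' *s b (q - q'))"

definition flconv ::
  "(int^3 \<Rightarrow> real \<Rightarrow> complex) \<Rightarrow> (int^3 \<Rightarrow> real \<Rightarrow> complex^3) \<Rightarrow> int^3 \<Rightarrow> real \<Rightarrow> complex^3" where
  "flconv a b k q = (\<Sum>\<^sub>\<infinity>k'. lconv (a k') (b (k - k')) q)"

definition leray :: "int^3 \<Rightarrow> complex^3 \<Rightarrow> complex^3" where
  "leray k w = (if k = 0 then 0 else
     w - ((\<Sum>j\<in>UNIV. of_int (k $ j) * w $ j) / of_real ((norm (wavevec k))\<^sup>2)) *s
         (\<chi> j. of_int (k $ j)))"

text \<open>Bessel functions of integer order; the second one for positive argument only.\<close>

definition bessel_J :: "nat \<Rightarrow> real \<Rightarrow> real" where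
  "bessel_J m x = (\<Sum>l. (-1) ^ l / (fact l * fact (l + m)) * (x / 2) ^ (2 * l + m))"

definition bessel_Y :: "nat \<Rightarrow> real \<Rightarrow> real" where
  "bessel_Y m x =
     2 / pi * ln (x / 2) * bessel_J m x
     - 1 / pi * (\<Sum>l<m. fact (m - l - 1) / fact l * (x / 2) ^ (2 * l) / (x / 2) ^ m)
     - 1 / pi * (\<Sum>l. (Digamma (real l + 1) + Digamma (real (l + m) + 1)) *
                      ((-1) ^ l / (fact l * fact (l + m)) * (x / 2) ^ (2 * l + m)))"

text \<open>The loop from \<open>\<infinity> exp(-i\<pi>)\<close> to \<open>\<infinity> exp(i\<pi>)\<close> counterclockwise around the origin is realised
  as \<open>-\<infinity> - i \<rightarrow> 1 - i \<rightarrow> 1 + i \<rightarrow> -\<infinity> + i\<close>. It avoids the negative real axis, so the powers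
  of \<open>\<zeta>\<close> below, with arguments running from \<open>-\<pi>\<close> to \<open>\<pi>\<close> along the loop, are the principal ones.\<close>

definition hankel_path :: "real \<Rightarrow> real \<Rightarrow> complex" where
  "hankel_path R = linepath (Complex (-R) (-1)) (Complex 1 (-1)) +++
     (linepath (Complex 1 (-1)) (Complex 1 1) +++ linepath (Complex 1 1) (Complex (-R) 1))"

definition hankel_integral :: "(complex \<Rightarrow> complex) \<Rightarrow> complex" where
  "hankel_integral h = Lim at_top (\<lambda>R. contour_integral (hankel_path R) h)"

definition F_fun :: "nat \<Rightarrow> real \<Rightarrow> complex" where
  "F_fun n \<mu> = 1 / (2 * of_real pi * \<i>) *
     hankel_integral (\<lambda>\<zeta>. \<zeta> powr (- 1 / of_nat n) * exp (\<zeta> - of_real \<mu> * \<zeta> powr (- 1 / of_nat n)))"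

definition G_fun :: "nat \<Rightarrow> real \<Rightarrow> complex" where
  "G_fun n \<mu> = - 1 / (2 * of_real pi * \<i>) *
     hankel_integral (\<lambda>\<zeta>. exp (\<zeta> - of_real \<mu> * \<zeta> powr (- 1 / of_nat n)))"

definition kernel :: "real \<Rightarrow> nat \<Rightarrow> real \<Rightarrow> real \<Rightarrow> int^3 \<Rightarrow> complex" where
  "kernel \<nu> n q q' k =
    (if k = 0 then 0
     else if n = 1 then
       (let z = 2 * norm (wavevec k) * sqrt (\<nu> * q);
            z' = 2 * norm (wavevec k) * sqrt (\<nu> * q')
        in of_real (pi * z' / z *
             (bessel_J 1 z * bessel_Y 1 z' - bessel_J 1 z' * bessel_Y 1 z)))
     else
       (let \<gamma> = q' / q; N = real n;
            \<mu> = (\<lambda>s. \<nu> * (norm (wavevec k))\<^sup>2 * q powr (1 / N) * (1 - s * \<gamma> powr (1 / N)) *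
                       (1 - s powr (- N)) powr (1 / N))
        in of_real (\<gamma> powr (1 / N) / (sqrt \<nu> * norm (wavevec k) * q powr (1 - 1 / (2 * N)))) *
           (LINT s:{1..\<gamma> powr (- 1 / N)}|lborel.
              of_real ((1 - s powr (- N)) powr (1 / (2 * N) - 1) *
                       (1 - s * \<gamma> powr (1 / N)) powr (- 1 / 2) * sqrt (\<mu> s)) * F_fun n (\<mu> s))))"

definition v1_hat ::
  "real \<Rightarrow> (int^3 \<Rightarrow> complex^3) \<Rightarrow> (int^3 \<Rightarrow> complex^3) \<Rightarrow> int^3 \<Rightarrow> complex^3" where
  "v1_hat \<nu> v0h fh k =
     - (of_real (\<nu> * (norm (wavevec k))\<^sup>2) *s v0h k)
     - (\<Sum>j\<in>UNIV. (\<i> * of_int (k $ j)) *s leray k (fconv (\<lambda>l. v0h l $ j) v0h k))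
     + fh k"

definition U0_hat ::
  "real \<Rightarrow> nat \<Rightarrow> (int^3 \<Rightarrow> complex^3) \<Rightarrow> (int^3 \<Rightarrow> complex^3) \<Rightarrow> int^3 \<Rightarrow> real \<Rightarrow> complex^3" where
  "U0_hat \<nu> n v0h fh k q =
    (if k = 0 then 0
     else if n = 1 then
       (let z = 2 * norm (wavevec k) * sqrt (\<nu> * q)
        in of_real (2 * bessel_J 1 z / z) *s v1_hat \<nu> v0h fh k)
     else
       (G_fun n (\<nu> * (norm (wavevec k))\<^sup>2 * q powr (1 / real n)) /
          of_real (\<nu> * (norm (wavevec k))\<^sup>2 * q)) *s v1_hat \<nu> v0h fh k)"

definition H_hat ::
  "(int^3 \<Rightarrow> complex^3) \<Rightarrow> (int^3 \<Rightarrow> real \<Rightarrow> complex^3) \<Rightarrow> 3 \<Rightarrow> int^3 \<Rightarrow> real \<Rightarrow> complex^3" where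
  "H_hat v0h U j k q = leray k
     (fconv (\<lambda>l. v0h l $ j) (\<lambda>l. U l q) k + fconv (\<lambda>l. U l q $ j) v0h k +
      flconv (\<lambda>l p. U l p $ j) U k q)"

text \<open>The right-hand side of the integral equation, with upper limit \<open>r\<close> of integration.\<close>

definition duhamel ::
  "real \<Rightarrow> nat \<Rightarrow> (int^3 \<Rightarrow> complex^3) \<Rightarrow> (int^3 \<Rightarrow> complex^3) \<Rightarrow> (int^3 \<Rightarrow> real \<Rightarrow> complex^3) \<Rightarrow>
   real \<Rightarrow> int^3 \<Rightarrow> real \<Rightarrow> complex^3" where
  "duhamel \<nu> n v0h fh U r k q =
     - (\<Sum>j\<in>UNIV. (\<i> * of_int (k $ j)) *s
          (LINT q':{0..r}|lborel. kernel \<nu> n q q' k *s H_hat v0h U j k q'))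
     + U0_hat \<nu> n v0h fh k q"

text \<open>Solutions are elements of a weighted \<open>L\<^sup>1\<close> space in \<open>q\<close>, so the equation is required for
  almost all \<open>q\<close>. As the Bochner integral is total, existence of the integrals in the equation
  is stated separately. At \<open>k = 0\<close> the equation reads \<open>U 0 q = 0\<close>.\<close>

definition IE_solution ::
  "real \<Rightarrow> nat \<Rightarrow> (int^3 \<Rightarrow> complex^3) \<Rightarrow> (int^3 \<Rightarrow> complex^3) \<Rightarrow> (int^3 \<Rightarrow> real \<Rightarrow> complex^3) \<Rightarrow> bool"
  where
  "IE_solution \<nu> n v0h fh U \<longleftrightarrow>
     (\<forall>k. set_borel_measurable lborel {0<..} (U k)) \<and>
     (AE q in lborel. 0 < q \<longrightarrow>
        (\<forall>k. (\<forall>j. set_integrable lborel {0..q} (\<lambda>q'. kernel \<nu> n q q' k *s H_hat v0h U j k q')) \<and>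
             U k q = duhamel \<nu> n v0h fh U q k q)) \<and>
     (\<forall>\<^sub>F \<alpha>' in at_top.
        (\<integral>\<^sup>+q\<in>{0<..}. (ennreal (exp (- \<alpha>' * q)) * l1norm (\<lambda>k. U k q)) \<partial>lborel) < \<infinity>)"

text \<open>All functionals take values in \<open>[0,\<infinity>]\<close>, so that a divergent integral or an unbounded
  supremum is \<open>\<infinity>\<close> rather than a default value.\<close>

definition Ua :: "real \<Rightarrow> (int^3 \<Rightarrow> real \<Rightarrow> complex^3) \<Rightarrow> int^3 \<Rightarrow> real \<Rightarrow> complex^3" where
  "Ua q0 U k q = (if 0 < q \<and> q \<le> q0 then U k q else 0)"

definition Us ::
  "real \<Rightarrow> nat \<Rightarrow> (int^3 \<Rightarrow> complex^3) \<Rightarrow> (int^3 \<Rightarrow> complex^3) \<Rightarrow> real \<Rightarrow>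
   (int^3 \<Rightarrow> real \<Rightarrow> complex^3) \<Rightarrow> int^3 \<Rightarrow> real \<Rightarrow> complex^3" where
  "Us \<nu> n v0h fh q0 U k q = duhamel \<nu> n v0h fh (Ua q0 U) (min q (2 * q0)) k q"

definition B0 :: "real \<Rightarrow> nat \<Rightarrow> real \<Rightarrow> int^3 \<Rightarrow> ennreal" where
  "B0 \<nu> n q0 k = (SUP (q', q) \<in> {(q', q). q0 \<le> q' \<and> q' \<le> q}.
     ennreal ((q - q') powr (1 / 2 - 1 / (2 * real n)) * norm (kernel \<nu> n q q' k)))"

definition sup_kB0 :: "real \<Rightarrow> nat \<Rightarrow> real \<Rightarrow> ennreal" where
  "sup_kB0 \<nu> n q0 = (SUP k. ennreal (norm (wavevec k)) * B0 \<nu> n q0 k)"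

definition B1 :: "real \<Rightarrow> nat \<Rightarrow> (int^3 \<Rightarrow> complex^3) \<Rightarrow> real \<Rightarrow> ennreal" where
  "B1 \<nu> n v0h q0 = 4 * sup_kB0 \<nu> n q0 * l1norm v0h"

definition B2 :: "real \<Rightarrow> nat \<Rightarrow> real \<Rightarrow> (int^3 \<Rightarrow> real \<Rightarrow> complex^3) \<Rightarrow> real \<Rightarrow> ennreal" where
  "B2 \<nu> n q0 U q = 4 * sup_kB0 \<nu> n q0 * l1norm (\<lambda>k. Ua q0 U k q)"

definition B3 :: "real \<Rightarrow> nat \<Rightarrow> real \<Rightarrow> ennreal" where
  "B3 \<nu> n q0 = 2 * sup_kB0 \<nu> n q0"

definition b_fun ::
  "real \<Rightarrow> nat \<Rightarrow> (int^3 \<Rightarrow> complex^3) \<Rightarrow> (int^3 \<Rightarrow> complex^3) \<Rightarrow> real \<Rightarrow> real \<Rightarrow>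
   (int^3 \<Rightarrow> real \<Rightarrow> complex^3) \<Rightarrow> ennreal" where
  "b_fun \<nu> n v0h fh q0 \<alpha> U = ennreal (\<alpha> powr (1 / 2 + 1 / (2 * real n))) *
     (\<integral>\<^sup>+q\<in>{q0<..}. (ennreal (exp (- \<alpha> * q)) * l1norm (\<lambda>k. Us \<nu> n v0h fh q0 U k q)) \<partial>lborel)"

definition eps1 ::
  "real \<Rightarrow> nat \<Rightarrow> (int^3 \<Rightarrow> complex^3) \<Rightarrow> real \<Rightarrow> real \<Rightarrow> (int^3 \<Rightarrow> real \<Rightarrow> complex^3) \<Rightarrow> ennreal" where
  "eps1 \<nu> n v0h q0 \<alpha> U = ennreal (Gamma (1 / 2 + 1 / (2 * real n))) *
     (B1 \<nu> n v0h q0 + (\<integral>\<^sup>+q\<in>{0<..q0}. (ennreal (exp (- \<alpha> * q)) * B2 \<nu> n q0 U q) \<partial>lborel))"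

definition eps :: "real \<Rightarrow> nat \<Rightarrow> real \<Rightarrow> ennreal" where
  "eps \<nu> n q0 = ennreal (Gamma (1 / 2 + 1 / (2 * real n))) * B3 \<nu> n q0"

definition enn_sqrt :: "ennreal \<Rightarrow> ennreal" where
  "enn_sqrt x = (if x = \<infinity> then \<infinity> else ennreal (sqrt (enn2real x)))"

end

theory Submission
  imports Defs
begin

text \<open>
  Let \<open>u(q)\<close> be the \<open>l\<^sup>1\<close> norm of \<open>U(\<cdot>,q)\<close>, let \<open>us(q)\<close> be that of \<open>Us\<close>, put \<open>\<beta> = 1/2 - 1/(2n)\<close>,
  and let \<open>S\<close> be the supremum \<open>sup_kB0\<close>, so that \<open>\<bar>k\<bar> \<bar>kernel(q,q';k)\<bar> \<le> S (q - q') powr (- \<beta>)\<close> for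
  \<open>q0 \<le> q' < q\<close>.

  The nonlinear terms of \<open>U\<close> and of its restriction \<open>Ua\<close> to \<open>(0, q0]\<close> agree on \<open>(0, q0]\<close>, and that
  of \<open>Ua\<close> vanishes beyond \<open>2 q0\<close>. Therefore \<open>U - Us\<close> is the Duhamel integral over \<open>(q0, q)\<close> of
  the difference of the two, in which every term contains the tail of \<open>U\<close> beyond \<open>q0\<close>. Taking
  norms and writing \<open>ub\<close> for the tail of \<open>u\<close> gives,
      for almost all \<open>q > q0\<close>, the scalar inequality (lemma \<open>tail_inequality\<close>)
  \<open>u(q) \<le> us(q) + 2 S \<integral> (q - q') powr (- \<beta>) h(q') dq'\<close> with
  \<open>h = 2 V ub + ub * u + ua * ub\<close>, where \<open>*\<close> is Laplace convolution, \<open>ua = u - ub\<close>, and \<open>V\<close> is the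
  \<open>l\<^sup>1\<close> norm of the Fourier coefficients of \<open>v0\<close>.

  Multiplying by \<open>exp (- \<alpha> q)\<close> and integrating over \<open>(q0, L]\<close> turns this into
  \<open>A Y \<le> b + \<epsilon>\<^sub>1 Y + \<epsilon> Y\<^sup>2\<close> for \<open>Y = Y(L) = \<integral> exp (- \<alpha> q) u(q) dq\<close>, the integral being taken over
  \<open>(q0, L]\<close>, and \<open>A = \<alpha> powr (1 - \<beta>)\<close>. As \<open>Y\<close> is continuous
  with \<open>Y(q0) = 0\<close>, and \<open>A > \<epsilon>\<^sub>1 + 2 sqrt (\<epsilon> b)\<close> makes the inequality fail at some positive level,
  \<open>Y\<close> never crosses that level (lemmas \<open>quadratic_barrier\<close> and \<open>laplace_bootstrap\<close>). Letting
  \<open>L \<rightarrow> \<infinity>\<close> gives the claim.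

  The finiteness of \<open>S\<close> is not needed. If \<open>S = \<infinity>\<close>, the hypothesis forces \<open>V = 0\<close>, \<open>u = 0\<close> almost
  everywhere on \<open>(0, q0]\<close> and \<open>b = 0\<close>, and then \<open>U\<close> vanishes almost everywhere on \<open>(0, \<infinity>)\<close> by
  doubling of supports (lemma \<open>vanishing_propagates\<close>).

  Bochner integrals of non-measurable functions have the value \<open>0\<close>. The comparison of \<open>U\<close> with
  \<open>Us\<close> therefore depends on the measurability of the kernel in \<open>q'\<close>, which for \<open>n \<ge> 2\<close> requires the
  convergence of the Hankel integral defining \<open>F_fun\<close>.
\<close>

section \<open>Measurability of the kernel\<close>

text \<open>The integrand of the contour integral defining \<open>F_fun\<close>.\<close>

definition hankel_integrand :: "nat \<Rightarrow> real \<Rightarrow> complex \<Rightarrow> complex" where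
  "hankel_integrand n \<mu> \<zeta> = \<zeta> powr (- 1 / of_nat n) * exp (\<zeta> - of_real \<mu> * \<zeta> powr (- 1 / of_nat n))"

lemma contour_integral_linepath_translate:
  "contour_integral (linepath (a + w) (b + w)) f = contour_integral (linepath a b) (\<lambda>z. f (z + w))"
  by (simp add: contour_integral_integral linepath_def algebra_simps scaleR_conv_of_real)

lemma contour_integral_linepath_horizontal:
  assumes "x < y"
  shows "contour_integral (linepath (Complex x c) (Complex y c)) f =
      integral {x..y} (\<lambda>t. f (Complex t c))"
proof -
  have "contour_integral (linepath (Complex x c) (Complex y c)) f
      = contour_integral (linepath (of_real x + Complex 0 c) (of_real y + Complex 0 c)) f"
    by (simp add: complex_of_real_def complex_add)
  also have "\<dots> = integral {x..y} (\<lambda>t. f (of_real t + Complex 0 c))"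
    unfolding contour_integral_linepath_translate
    by (subst contour_integral_linepath_Reals_eq) (use assms in auto)
  finally show ?thesis by (simp add: complex_of_real_def complex_add)
qed

lemma continuous_on_hankel_integrand:
  assumes g: "continuous_on A g" and m: "continuous_on A m" and "\<And>x. x \<in> A \<Longrightarrow> g x \<notin> \<real>\<^sub>\<le>\<^sub>0"
  shows "continuous_on A (\<lambda>x. hankel_integrand n (m x) (g x))"
proof -
  have "continuous_on A (\<lambda>x. g x powr (- 1 / of_nat n))"
    unfolding continuous_on_def
    using g m assms(3) by (auto simp: continuous_on_def intro!: tendsto_powr_complex)
  from this g m show ?thesis
    unfolding hankel_integrand_def
    by (intro continuous_on_mult continuous_on_exp continuous_on_diff continuous_on_of_real)
qed

lemma notin_nonpos_Reals: "Im z \<noteq> 0 \<or> Re z > 0 \<Longrightarrow> z \<notin> \<real>\<^sub>\<le>\<^sub>0"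
  by (auto simp: complex_nonpos_Reals_iff)

lemma segment_notin_nonpos_Reals:
  assumes "z \<in> closed_segment a b" "Im a = Im b \<and> Im a \<noteq> 0 \<or> Re a = Re b \<and> Re a > 0"
  shows "z \<notin> \<real>\<^sub>\<le>\<^sub>0"
proof -
  obtain u where u: "z = (1 - u) *\<^sub>R a + u *\<^sub>R b" using assms(1) by (auto simp: in_segment)
  have "Im z = Im a" if "Im a = Im b" using that by (simp add: u algebra_simps)
  moreover have "Re z = Re a" if "Re a = Re b" using that by (simp add: u algebra_simps)
  ultimately show ?thesis using assms(2) by (intro notin_nonpos_Reals) auto
qed

lemma norm_powr_inv_le_1:
  fixes z :: complex
  assumes "norm z \<ge> 1"
  shows "norm (z powr (- 1 / of_nat n)) \<le> 1"
proof -
  have z: "z \<noteq> 0" using assms by auto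
  have "- 1 / of_nat n = (of_real (- 1 / real n) :: complex)" by simp
  then have "norm (z powr (- 1 / of_nat n)) = norm z powr (- 1 / real n)"
    using norm_powr_real_powr'[of "of_real (- 1 / real n)" z] by simp
  also have "\<dots> \<le> 1 powr (- 1 / real n)"
    using assms by (intro powr_mono2') auto
  finally show ?thesis by simp
qed

lemma norm_hankel_integrand_le:
  assumes "norm z \<ge> 1"
  shows "norm (hankel_integrand n \<mu> z) \<le> exp (Re z + \<bar>\<mu>\<bar>)"
proof -
  let ?p = "z powr (- 1 / of_nat n)"
  have p: "norm ?p \<le> 1" using norm_powr_inv_le_1[OF assms] .
  have "norm (hankel_integrand n \<mu> z) \<le> 1 * exp (Re (z - of_real \<mu> * ?p))"
    unfolding hankel_integrand_def norm_mult norm_exp_eq_Re using p by (intro mult_right_mono) auto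
  also have "Re (z - of_real \<mu> * ?p) \<le> Re z + \<bar>\<mu>\<bar>"
  proof -
    have "\<bar>Re (of_real \<mu> * ?p)\<bar> \<le> norm (of_real \<mu> * ?p)" by (rule abs_Re_le_cmod)
    also have "\<dots> \<le> \<bar>\<mu>\<bar> * 1" unfolding norm_mult using p by (intro mult_mono) auto
    finally show ?thesis by simp
  qed
  finally show ?thesis by simp
qed

lemma set_integrable_exp_atMost: "set_integrable lborel {..b::real} exp"
proof -
  have "(\<integral>\<^sup>+x. ennreal (exp (-x)) * indicator {-b..} x \<partial>lborel) = ennreal (0 - (- exp (- (- b))))"
  proof (rule nn_integral_FTC_atLeast)
    have "((\<lambda>x::real. exp (-x)) \<longlongrightarrow> 0) at_top"
      by (rule filterlim_compose[OF exp_at_bot filterlim_uminus_at_bot_at_top])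
    from tendsto_minus[OF this] show "((\<lambda>x::real. - exp (-x)) \<longlongrightarrow> 0) at_top" by simp
  qed (auto intro!: derivative_eq_intros)
  also have "(\<integral>\<^sup>+x. ennreal (exp (-x)) * indicator {-b..} x \<partial>lborel) =
      (\<integral>\<^sup>+x. ennreal (norm (indicator {-b..} x * exp (-x))) \<partial>lborel)"
    by (intro nn_integral_cong) (auto simp: indicator_def)
  finally have "integrable lborel (\<lambda>x. indicator {-b..} x * exp (-x))"
    by (intro integrableI_bounded) auto
  note lborel_integrable_real_affine[OF this, of "-1" 0]
  moreover have "(\<lambda>x. indicator {-b..} (0 + - 1 * x) * exp (- (0 + - 1 * x))) =
      (\<lambda>x. indicat_real {..b} x *\<^sub>R exp x)"
    by (auto simp: fun_eq_iff indicator_def)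
  ultimately show ?thesis
    unfolding set_integrable_def by simp
qed

lemma set_integrable_hankel_integrand:
  assumes c: "\<bar>c\<bar> = 1"
  shows "set_integrable lborel {..1} (\<lambda>x. hankel_integrand n \<mu> (Complex x c))"
proof -
  have *: "(\<lambda>x. hankel_integrand n \<mu> (Complex x c)) \<in> borel_measurable borel"
    using c by (intro borel_measurable_continuous_onI continuous_on_hankel_integrand
        continuous_intros notin_nonpos_Reals) auto
  show ?thesis
    unfolding set_integrable_def
  proof (rule Bochner_Integration.integrable_bound)
    show "integrable lborel (\<lambda>x. indicator {..1} x *\<^sub>R (exp \<bar>\<mu>\<bar> * exp x))"
      using set_integrable_exp_atMost[of 1, THEN set_integrable_mult_right[of "exp \<bar>\<mu>\<bar>"]]
      by (simp add: set_integrable_def)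
    show "(\<lambda>x. indicator {..1} x *\<^sub>R hankel_integrand n \<mu> (Complex x c)) \<in> borel_measurable lborel"
      using * by simp
    have "norm (hankel_integrand n \<mu> (Complex x c)) \<le> exp \<bar>\<mu>\<bar> * exp x" for x
    proof -
      have "1 \<le> norm (Complex x c)" using c abs_Im_le_cmod[of "Complex x c"] by simp
      from norm_hankel_integrand_le[OF this, of n \<mu>] show ?thesis
          by (simp add: exp_add mult.commute)
    qed
    then show "AE x in lborel. norm (indicator {..1} x *\<^sub>R hankel_integrand n \<mu> (Complex x c))
       \<le> norm (indicator {..1} x *\<^sub>R (exp \<bar>\<mu>\<bar> * exp x))"
      by (auto simp: indicator_def)
  qed
qed

text \<open>On the horizontal half-lines of the loop the integrand is dominated by a constant multiple of
  \<open>exp (Re \<zeta>)\<close>, because \<open>\<bar>\<zeta>\<bar> \<ge> 1\<close> there. Hence the limit defining the Hankel integral exists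
  and is an integral over the whole half-line.\<close>

lemma tendsto_integral_hankel_integrand:
  assumes c: "\<bar>c\<bar> = 1"
  shows "((\<lambda>R. integral {-R..1} (\<lambda>x. hankel_integrand n \<mu> (Complex x c))) \<longlongrightarrow>
           (LINT x:{..1}|lborel. hankel_integrand n \<mu> (Complex x c))) at_top"
proof -
  let ?h = "\<lambda>x. hankel_integrand n \<mu> (Complex x c)"
  have si: "set_integrable lborel {..1} ?h" by (rule set_integrable_hankel_integrand[OF c])
  have eq: "integral {-R..1} ?h = (LINT x|lborel. indicator {-R..1} x *\<^sub>R ?h x)" for R
  proof -
    have "set_integrable lborel {-R..1} ?h"
      by (rule set_integrable_subset[OF si]) auto
    from set_borel_integral_eq_integral(2)[OF this] show ?thesis
      by (simp add: set_lebesgue_integral_def)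
  qed
  have ae: "AE x in lborel. ((\<lambda>R. indicator {-R..1} x *\<^sub>R ?h x) \<longlongrightarrow> indicator {..1} x *\<^sub>R ?h x)
      at_top"
  proof (intro AE_I2 tendsto_eventually)
    fix x :: real
    show "\<forall>\<^sub>F R in at_top. indicator {-R..1} x *\<^sub>R ?h x = indicator {..1} x *\<^sub>R ?h x"
      using eventually_ge_at_top[of "-x"] by eventually_elim (auto simp: indicator_def)
  qed
  have m: "?h \<in> borel_measurable borel"
    using c by (intro borel_measurable_continuous_onI continuous_on_hankel_integrand
        continuous_intros notin_nonpos_Reals) auto
  show ?thesis
    unfolding eq set_lebesgue_integral_def
    by (rule integral_dominated_convergence_at_top[where w="\<lambda>x. norm (indicator {..1} x *\<^sub>R ?h x)"])
       (use m ae integrable_norm[OF si[unfolded set_integrable_def]] in \<open>auto simp: indicator_def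
           simp del: norm_scaleR\<close>)
qed

lemma hankel_integral_hankel_integrand:
  "hankel_integral (hankel_integrand n \<mu>) =
     (LINT x:{..1}|lborel. hankel_integrand n \<mu> (Complex x (-1))) +
     contour_integral (linepath (Complex 1 (-1)) (Complex 1 1)) (hankel_integrand n \<mu>) -
     (LINT x:{..1}|lborel. hankel_integrand n \<mu> (Complex x 1))" (is "_ = ?I1 + ?M - ?I2")
proof -
  have ci: "hankel_integrand n \<mu> contour_integrable_on linepath a b"
    if "Im a = Im b \<and> Im a \<noteq> 0 \<or> Re a = Re b \<and> Re a > 0" for a b
    using segment_notin_nonpos_Reals[OF _ that]
    by (intro contour_integrable_continuous_linepath continuous_on_hankel_integrand
        continuous_intros)
  have seg1: "hankel_integrand n \<mu> contour_integrable_on linepath (Complex (-R) c) (Complex 1 c)"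
      if "\<bar>c\<bar> = 1" for R c
    by (rule ci) (use that in auto)
  have seg2: "hankel_integrand n \<mu> contour_integrable_on linepath (Complex 1 c) (Complex (-R) c)"
      if "\<bar>c\<bar> = 1" for R c
    by (rule ci) (use that in auto)
  have seg3: "hankel_integrand n \<mu> contour_integrable_on linepath (Complex 1 (-1)) (Complex 1 1)"
    by (rule ci) auto
  have eq: "contour_integral (hankel_path R) (hankel_integrand n \<mu>) =
      integral {-R..1} (\<lambda>x. hankel_integrand n \<mu> (Complex x (-1))) + ?M
      - integral {-R..1} (\<lambda>x. hankel_integrand n \<mu> (Complex x 1))" if "R \<ge> 0" for R
  proof -
    have "contour_integral (linepath (Complex 1 1) (Complex (-R) 1)) (hankel_integrand n \<mu>) =
        - contour_integral (linepath (Complex (-R) 1) (Complex 1 1)) (hankel_integrand n \<mu>)"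
      by (intro contour_integral_reverse_linepath continuous_on_hankel_integrand continuous_intros)
         (rule segment_notin_nonpos_Reals, auto)
    then show ?thesis
      unfolding hankel_path_def
      using that seg1[of "-1" R] seg2[of 1 R] seg3
      by (simp add: contour_integral_linepath_horizontal contour_integrable_joinI)
  qed
  have "((\<lambda>R. integral {-R..1} (\<lambda>x. hankel_integrand n \<mu> (Complex x (-1))) + ?M
      - integral {-R..1} (\<lambda>x. hankel_integrand n \<mu> (Complex x 1))) \<longlongrightarrow> ?I1 + ?M - ?I2) at_top"
    by (intro tendsto_intros tendsto_integral_hankel_integrand) auto
  then have "((\<lambda>R. contour_integral (hankel_path R) (hankel_integrand n \<mu>)) \<longlongrightarrow> ?I1 +
      ?M - ?I2) at_top"
    by (rule Lim_transform_eventually) (use eventually_ge_at_top[of 0] in \<open>eventually_elim, simp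
        add: eq\<close>)
  then show ?thesis
    unfolding hankel_integral_def by (intro tendsto_Lim) auto
qed

text \<open>Each of the three pieces of the loop contributes an integral whose integrand is jointly
  continuous in \<open>\<mu>\<close> and the parameter of the curve.\<close>

lemma borel_measurable_F_fun [measurable]: "F_fun n \<in> borel_measurable borel"
proof -
  have m1: "(\<lambda>p. hankel_integrand n (fst p) (Complex (snd p) c)) \<in> borel_measurable (borel \<Otimes>\<^sub>M
      borel)" if "\<bar>c\<bar> = 1" for c
    unfolding borel_prod using that
    by (intro borel_measurable_continuous_onI continuous_on_hankel_integrand continuous_intros
        notin_nonpos_Reals) auto
  have I: "(\<lambda>\<mu>. LINT x:{..1}|lborel. hankel_integrand n \<mu> (Complex x c)) \<in> borel_measurable
      borel" if "\<bar>c\<bar> = 1" for c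
    unfolding set_lebesgue_integral_def
    by (rule lborel.borel_measurable_lebesgue_integral) (use m1[OF that] in \<open>simp add:
        case_prod_beta\<close>)
  have M: "(\<lambda>\<mu>. contour_integral (linepath (Complex 1 (-1)) (Complex 1 1)) (hankel_integrand n
      \<mu>)) \<in> borel_measurable borel"
  proof -
    let ?g = "linepath (Complex 1 (-1)) (Complex 1 1)"
    have Re: "Re (?g t) = 1" for t by (simp add: linepath_def algebra_simps)
    have c: "continuous_on UNIV ?g" 
      unfolding linepath_def by (intro continuous_intros)
    have c2: "continuous_on UNIV (\<lambda>p::real\<times>real. ?g (snd p))"
      by (rule continuous_on_compose2[OF c]) (auto intro: continuous_intros)
    have *: "contour_integral ?g (hankel_integrand n \<mu>) =
        (LINT t:{0..1}|lborel. hankel_integrand n \<mu> (?g t) * Complex 0 2)" for \<mu>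
    proof -
      have "set_integrable lborel {0..1} (\<lambda>t. hankel_integrand n \<mu> (?g t) * Complex 0 2)"
        by (intro borel_integrable_atLeastAtMost' continuous_intros continuous_on_hankel_integrand
            continuous_on_subset[OF c] notin_nonpos_Reals) (auto simp: Re)
      from set_borel_integral_eq_integral(2)[OF this]
      show ?thesis by (simp add: contour_integral_integral complex_diff del:
          set_integral_mult_left Henstock_Kurzweil_Integration.integral_mult_left)
    qed
    have "(\<lambda>p. hankel_integrand n (fst p) (?g (snd p))) \<in> borel_measurable (borel \<Otimes>\<^sub>M borel)"
      unfolding borel_prod
      by (intro borel_measurable_continuous_onI continuous_on_hankel_integrand c2
          notin_nonpos_Reals continuous_intros) (simp add: Re)
    then have "(\<lambda>p. indicat_real {0..1} (snd p) *\<^sub>R (hankel_integrand n (fst p) (?g (snd p)) *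
        Complex 0 2))
        \<in> borel_measurable (borel \<Otimes>\<^sub>M lborel)"
      by simp
    then show ?thesis
      unfolding * set_lebesgue_integral_def
      by (intro lborel.borel_measurable_lebesgue_integral) (simp add: case_prod_beta)
  qed
  have "F_fun n = (\<lambda>\<mu>. 1 / (2 * of_real pi * \<i>) * hankel_integral (hankel_integrand n \<mu>))"
    by (simp add: fun_eq_iff F_fun_def hankel_integrand_def[abs_def])
  then show ?thesis
    unfolding hankel_integral_hankel_integrand using I[of 1] I[of "-1"] M by simp
qed

lemma borel_measurable_bessel_J [measurable]: "bessel_J m \<in> borel_measurable borel"
  unfolding bessel_J_def[abs_def] by measurable

lemma borel_measurable_bessel_Y [measurable]: "bessel_Y m \<in> borel_measurable borel"
  unfolding bessel_Y_def[abs_def] by measurable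

text \<open>Without this the integrals in \<open>Us\<close>, whose existence is not among the
  hypotheses, could take the default value \<open>0\<close> of a non-measurable integrand.\<close>

lemma borel_measurable_kernel [measurable]: "(\<lambda>q'. kernel \<nu> n q q' k) \<in> borel_measurable borel"
proof -
  consider "k = 0" | "k \<noteq> 0" "n = 1" | "k \<noteq> 0" "n \<noteq> 1" by blast
  then show ?thesis
  proof cases
    case 1
    then show ?thesis by (simp add: kernel_def)
  next
    case 2
    then show ?thesis by (simp add: kernel_def Let_def)
  next
    case 3
    define N where "N = real n"
    define mu where "mu q' s = \<nu> * (norm (wavevec k))\<^sup>2 * q powr (1 / N) * (1 - s *
        (q' / q) powr (1 / N)) *
                       (1 - s powr (- N)) powr (1 / N)" for q' s
    define g where "g q' s = of_real ((1 - s powr (- N)) powr (1 / (2 * N) - 1) *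
                       (1 - s * (q' / q) powr (1 / N)) powr (- 1 / 2) * sqrt (mu q' s)) *
                           F_fun n (mu q' s)" for q' s
    have eq: "(\<lambda>q'. kernel \<nu> n q q' k) = (\<lambda>q'.
        of_real ((q' / q) powr (1 / N) / (sqrt \<nu> * norm (wavevec k) * q powr (1 - 1 / (2 * N)))) *
           (LINT s|lborel. (if 1 \<le> s \<and> s \<le> (q' / q) powr (- 1 / N) then 1 else 0) *\<^sub>R g q' s))"
      using 3 by (simp add: kernel_def Let_def set_lebesgue_integral_def g_def mu_def N_def
          indicator_def fun_eq_iff of_bool_def)
    have [measurable]: "(\<lambda>p. mu (fst p) (snd p)) \<in> borel_measurable (borel \<Otimes>\<^sub>M borel)"
      unfolding mu_def by measurable
    have [measurable]: "(\<lambda>p. g (fst p) (snd p)) \<in> borel_measurable (borel \<Otimes>\<^sub>M borel)"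
      unfolding g_def by measurable
    have "(\<lambda>p. (if 1 \<le> snd p \<and> snd p \<le> (fst p / q) powr (- 1 / N) then 1 else 0) *\<^sub>R g (fst p)
        (snd p))
        \<in> borel_measurable (borel \<Otimes>\<^sub>M lborel)"
      by measurable
    then have "(\<lambda>q'. LINT s|lborel. (if 1 \<le> s \<and> s \<le>
        (q' / q) powr (- 1 / N) then 1 else 0) *\<^sub>R g q' s)
        \<in> borel_measurable borel"
      by (intro lborel.borel_measurable_lebesgue_integral) (simp add: case_prod_beta)
    then show ?thesis unfolding eq by measurable
  qed
qed

section \<open>Vectors and the Leray projection\<close>

lemma norm_vector_scalar_mult: "norm (c *s v) = norm c * norm v" for v :: "complex^'n"
  unfolding norm_vec_def vector_scalar_mult_def
  by (simp add: norm_mult L2_set_right_distrib)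

lemma borel_measurable_vector_scalar_mult [measurable (raw)]:
  fixes f :: "'a \<Rightarrow> complex" and g :: "'a \<Rightarrow> complex^3"
  assumes f: "f \<in> borel_measurable M" and g: "g \<in> borel_measurable M"
  shows "(\<lambda>x. f x *s g x) \<in> borel_measurable M"
proof -
  have "continuous_on UNIV (\<lambda>p::complex \<times> (complex^3). fst p *s snd p)"
    unfolding vector_scalar_mult_def by (intro continuous_intros)
  from borel_measurable_continuous_Pair[OF f g, of "\<lambda>a b. a *s b"] this show ?thesis
    by simp
qed

lemma borel_measurable_vec_nth_compose [measurable (raw)]:
  fixes f :: "'a \<Rightarrow> complex^3"
  assumes f: "f \<in> borel_measurable M"
  shows "(\<lambda>x. f x $ j) \<in> borel_measurable M"
  by (rule borel_measurable_continuous_on[OF _ f, of "\<lambda>v. v $ j"]) (intro continuous_intros)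

lemma leray_0 [simp]: "leray k 0 = 0"
  by (simp add: leray_def vec_eq_iff)

lemma leray_diff: "leray k (v - w) = leray k v - leray k w"
  by (simp add: leray_def vec_eq_iff sum_subtractf algebra_simps diff_divide_distrib)

text \<open>The symbol of the Leray projection is an orthogonal projection of \<open>\<complex>\<^sup>3\<close>.\<close>

lemma norm_leray_le: "norm (leray k w) \<le> norm w"
proof (cases "k = 0")
  case False
  define t where "t = (norm (wavevec k))\<^sup>2"
  define s where "s = (\<Sum>j\<in>UNIV. of_int (k $ j) * w $ j)"
  have t_sum: "t = (\<Sum>j\<in>UNIV. (of_int (k $ j))\<^sup>2)"
    unfolding t_def norm_vec_def L2_set_def by (simp add: wavevec_def sum_nonneg)
  obtain j where "k $ j \<noteq> 0" using False by (auto simp: vec_eq_iff)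
  then have "0 < (\<Sum>j\<in>UNIV. (of_int (k $ j))\<^sup>2 :: real)"
    by (intro sum_pos2[of _ j]) auto
  then have t: "t > 0" by (simp add: t_sum)
  have cm: "(cmod (z - s / of_real t * of_int m))\<^sup>2 = (cmod z)\<^sup>2 - 2 / t * Re (cnj s *
      (of_int m * z)) + (cmod s)\<^sup>2 / t\<^sup>2 * (of_int m)\<^sup>2" for z m
    using t unfolding cmod_power2 by (simp add: field_simps power2_eq_square)
  have "(norm (leray k w))\<^sup>2 = (\<Sum>j\<in>UNIV. (cmod (w $ j - s / of_real t * of_int (k $ j)))\<^sup>2)"
    using False by (simp add: norm_vec_def L2_set_def sum_nonneg leray_def s_def t_def)
  also have "\<dots> = (\<Sum>j\<in>UNIV. (cmod (w $ j))\<^sup>2) - 2 / t * Re (cnj s * s) + (cmod s)\<^sup>2 / t\<^sup>2 * t"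
    unfolding cm by (simp only: sum.distrib sum_subtractf sum_distrib_left[symmetric] t_sum
        Re_sum[symmetric] s_def)
  also have "Re (cnj s * s) = (cmod s)\<^sup>2" unfolding cmod_power2 by (simp add: power2_eq_square)
  also have "(\<Sum>j\<in>UNIV. (cmod (w $ j))\<^sup>2) = (norm w)\<^sup>2"
      by (simp add: norm_vec_def L2_set_def sum_nonneg)
  also have "(norm w)\<^sup>2 - 2 / t * (cmod s)\<^sup>2 + (cmod s)\<^sup>2 / t\<^sup>2 * t = (norm w)\<^sup>2 - (cmod s)\<^sup>2 / t"
    using t by (simp add: field_simps power2_eq_square)
  also have "\<dots> \<le> (norm w)\<^sup>2" using t by simp
  finally show ?thesis by (simp add: power2_le_iff_abs_le)
qed (simp add: leray_def)

text \<open>The sharp constant is \<open>sqrt 3\<close>; the value \<open>2\<close> produces the constants \<open>4\<close> and \<open>2\<close> in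
  \<open>B1\<close>, \<open>B2\<close> and \<open>B3\<close>.\<close>

lemma sum_abs_component_le: "(\<Sum>j\<in>UNIV. \<bar>of_int (k $ j)\<bar>) \<le> 2 * norm (wavevec k)"
proof -
  let ?a = "\<lambda>j. \<bar>real_of_int (k $ j)\<bar>"
  have "(\<Sum>j\<in>UNIV. ?a j) = (\<Sum>j\<in>(UNIV::3 set). \<bar>?a j\<bar> * \<bar>1\<bar>)" by simp
  also have "\<dots> \<le> L2_set ?a UNIV * L2_set (\<lambda>_. 1) (UNIV :: 3 set)" by (rule L2_set_mult_ineq)
  also have "L2_set (\<lambda>_. 1) (UNIV :: 3 set) = sqrt 3" by (simp add: L2_set_def)
  also have "L2_set ?a UNIV = norm (wavevec k)" by (simp add: norm_vec_def wavevec_def L2_set_def)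
  also have "sqrt 3 \<le> 2" by (rule real_le_lsqrt) auto
  then have "norm (wavevec k) * sqrt 3 \<le> 2 * norm (wavevec k)" 
    using mult_left_mono[of "sqrt 3" 2 "norm (wavevec k)"] by simp
  finally show ?thesis .
qed

lemma norm_wavevec_ge_1: "k \<noteq> 0 \<Longrightarrow> 1 \<le> norm (wavevec k)"
proof -
  assume "k \<noteq> 0"
  then obtain j where "k $ j \<noteq> 0" by (auto simp: vec_eq_iff)
  then have "1 \<le> \<bar>wavevec k $ j\<bar>" by (simp add: wavevec_def)
  also have "\<dots> \<le> norm (wavevec k)" using Finite_Cartesian_Product.norm_nth_le[of "wavevec k" j]
      by simp
  finally show ?thesis .
qed

section \<open>Unordered sums as integrals\<close>

text \<open>In finite dimension summability is absolute summability, so both sides also agree when they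
  take their default value \<open>0\<close>. This makes Fourier convolutions accessible to measure theory.\<close>

lemma infsum_eq_integral_count_space:
  fixes f :: "'a \<Rightarrow> complex^'n"
  shows "infsum f UNIV = (LINT x|count_space UNIV. f x)"
proof (cases "integrable (count_space UNIV) f")
  case True
  then have "Infinite_Set_Sum.abs_summable_on f UNIV" by (simp add: abs_summable_on_def)
  from infsetsum_infsum[OF this] show ?thesis by (simp add: infsetsum_def)
next
  case False
  have "\<not> f summable_on UNIV"
  proof
    assume s: "f summable_on UNIV"
    have "(\<lambda>x. f x $ j) summable_on UNIV" for j
      using summable_on_bounded_linear[OF bounded_linear_vec_nth s, of j] by (simp add: o_def)
    then have "Infinite_Set_Sum.abs_summable_on (\<lambda>x. f x $ j) UNIV" for j
      by (simp add: summable_on_iff_abs_summable_on_complex abs_summable_equivalent)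
    then have int: "integrable (count_space UNIV) (\<lambda>x. \<Sum>j\<in>UNIV. norm (f x $ j))"
      by (intro Bochner_Integration.integrable_sum integrable_norm) (simp add: abs_summable_on_def)
    have "integrable (count_space UNIV) f"
      by (rule Bochner_Integration.integrable_bound[OF int])
         (auto simp: norm_vec_def intro!: order_trans[OF L2_set_le_sum] AE_I2)
    with False show False by simp
  qed
  with False show ?thesis by (simp add: infsum_not_exists not_integrable_integral_eq)
qed

lemma borel_measurable_infsum:
  fixes f :: "'i::countable \<Rightarrow> 'a \<Rightarrow> complex^'n"
  assumes "\<And>i. f i \<in> borel_measurable M"
  shows "(\<lambda>x. infsum (\<lambda>i. f i x) UNIV) \<in> borel_measurable M"
  unfolding infsum_eq_integral_count_space
proof (rule sigma_finite_measure.borel_measurable_lebesgue_integral)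
  show "sigma_finite_measure (count_space (UNIV :: 'i set))"
    by (rule sigma_finite_measure_count_space)
  show "(\<lambda>(x, i). f i x) \<in> borel_measurable (M \<Otimes>\<^sub>M count_space UNIV)"
    unfolding case_prod_beta
    by (rule measurable_compose_countable[OF measurable_compose[OF measurable_fst assms]
        measurable_snd])
qed

lemma norm_integral_diff_le:
  fixes f g :: "'a \<Rightarrow> 'b::{banach, second_countable_topology}"
  assumes "integrable M f" "integrable M g"
  shows "ennreal (norm ((LINT x|M. f x) - (LINT x|M. g x))) \<le> (\<integral>\<^sup>+x. ennreal (norm (f x - g x)) \<partial>M)"
  using integral_norm_bound_ennreal[OF Bochner_Integration.integrable_diff[OF assms]] assms by simp

lemma borel_measurable_nn_integral_count_space:
  fixes f :: "'i::countable \<Rightarrow> 'a \<Rightarrow> ennreal"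
  assumes "\<And>i. f i \<in> borel_measurable M"
  shows "(\<lambda>x. \<integral>\<^sup>+i. f i x \<partial>count_space UNIV) \<in> borel_measurable M"
proof (rule sigma_finite_measure.borel_measurable_nn_integral)
  show "sigma_finite_measure (count_space (UNIV :: 'i set))"
    by (rule sigma_finite_measure_count_space)
  show "(\<lambda>(x, i). f i x) \<in> borel_measurable (M \<Otimes>\<^sub>M count_space UNIV)"
    unfolding case_prod_beta
    by (rule measurable_compose_countable[OF measurable_compose[OF measurable_fst assms]
        measurable_snd])
qed

lemma borel_measurable_l1norm:
  assumes [measurable]: "\<And>k. X k \<in> borel_measurable borel"
  shows "(\<lambda>q. l1norm (\<lambda>k. X k q)) \<in> borel_measurable borel"
  unfolding l1norm_def by (rule borel_measurable_nn_integral_count_space) measurable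

lemma norm_le_l1norm: "ennreal (norm (g k)) \<le> l1norm g"
  unfolding l1norm_def by (rule nn_integral_ge_point) simp

lemma l1norm_eq_0_iff: "l1norm g = 0 \<longleftrightarrow> (\<forall>k. g k = 0)"
proof
  assume "l1norm g = 0"
  then have "ennreal (norm (g k)) \<le> 0" for k using norm_le_l1norm[of g k] by simp
  then show "\<forall>k. g k = 0" by simp
qed (simp add: l1norm_def)

lemma nn_integral_count_space_shift:
  fixes f :: "'i::ab_group_add \<Rightarrow> ennreal"
  shows "(\<integral>\<^sup>+k. f (k - l) \<partial>count_space UNIV) = (\<integral>\<^sup>+k. f k \<partial>count_space UNIV)"
  by (rule nn_integral_bij_count_space) (auto intro!: bij_betwI[of _ _ _ "\<lambda>k. k + l"])

section \<open>Laplace convolution and a quadratic integral inequality\<close>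

text \<open>Convolution on the real line of functions with values in \<open>[0,\<infinity>]\<close>.\<close>

definition nconv :: "(real \<Rightarrow> ennreal) \<Rightarrow> (real \<Rightarrow> ennreal) \<Rightarrow> real \<Rightarrow> ennreal" where
  "nconv f g x = (\<integral>\<^sup>+y. f y * g (x - y) \<partial>lborel)"

lemma borel_measurable_nconv [measurable (raw)]:
  assumes [measurable]: "f \<in> borel_measurable borel" "g \<in> borel_measurable borel"
  shows "nconv f g \<in> borel_measurable borel"
  unfolding nconv_def[abs_def] by measurable

lemma nn_integral_nconv:
  assumes [measurable]: "f \<in> borel_measurable borel" "g \<in> borel_measurable borel"
  shows "(\<integral>\<^sup>+x. nconv f g x \<partial>lborel) = (\<integral>\<^sup>+x. f x \<partial>lborel) * (\<integral>\<^sup>+x. g x \<partial>lborel)"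
proof -
  have "(\<integral>\<^sup>+x. nconv f g x \<partial>lborel) = (\<integral>\<^sup>+y. \<integral>\<^sup>+x. f y * g (x - y) \<partial>lborel \<partial>lborel)"
    unfolding nconv_def by (rule lborel_pair.Fubini') measurable
  also have "\<dots> = (\<integral>\<^sup>+y. f y * (\<integral>\<^sup>+x. g x \<partial>lborel) \<partial>lborel)"
  proof (rule nn_integral_cong)
    fix y :: real
    have "(\<integral>\<^sup>+x. g x \<partial>lborel) = (\<integral>\<^sup>+x. g (x - y) \<partial>lborel)"
      using nn_integral_real_affine[of g 1 "-y"] by simp
    then show "(\<integral>\<^sup>+x. f y * g (x - y) \<partial>lborel) = f y * (\<integral>\<^sup>+x. g x \<partial>lborel)"
      by (simp add: nn_integral_cmult)
  qed
  also have "\<dots> = (\<integral>\<^sup>+x. f x \<partial>lborel) * (\<integral>\<^sup>+x. g x \<partial>lborel)"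
    by (rule nn_integral_multc) simp
  finally show ?thesis .
qed

lemma exp_weight_nconv:
  assumes [measurable]: "f \<in> borel_measurable borel" "g \<in> borel_measurable borel"
  shows "ennreal (exp (- \<alpha> * x)) * nconv f g x =
    nconv (\<lambda>y. ennreal (exp (- \<alpha> * y)) * f y) (\<lambda>y. ennreal (exp (- \<alpha> * y)) * g y) x"
proof -
  have "ennreal (exp (- \<alpha> * x)) = ennreal (exp (- \<alpha> * y)) * ennreal (exp (- \<alpha> * (x - y)))" for y
    by (simp add: ennreal_mult[symmetric] exp_add[symmetric] algebra_simps)
  then have "ennreal (exp (- \<alpha> * x)) * (f y * g (x - y)) =
      (ennreal (exp (- \<alpha> * y)) * f y) * (ennreal (exp (- \<alpha> * (x - y))) * g (x - y))" for y
    by (metis (no_types, opaque_lifting) mult.assoc mult.commute)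
  then show ?thesis
    unfolding nconv_def by (subst nn_integral_cmult[symmetric]) simp_all
qed

lemma nn_integral_exp_powr:
  fixes s \<alpha> :: real
  assumes "s > 0" "\<alpha> > 0"
  shows "(\<integral>\<^sup>+t. (if 0 < t then ennreal (exp (- \<alpha> * t) * t powr (s - 1)) else 0) \<partial>lborel)
    = ennreal (Gamma s / \<alpha> powr s)"
proof -
  have "ennreal (Gamma s) = \<bar>\<alpha>\<bar> * (\<integral>\<^sup>+t. ennreal (indicator {0..} (0 + \<alpha> * t) * (0 + \<alpha> *
      t) powr (s - 1) / exp (0 + \<alpha> * t)) \<partial>lborel)"
    unfolding Gamma_conv_nn_integral_real[OF assms(1)]
    by (rule nn_integral_real_affine) (use assms in auto)
  also have "(\<lambda>t. ennreal (indicator {0..} (0 + \<alpha> * t) * (0 + \<alpha> * t) powr (s - 1) / exp (0 + \<alpha> *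
      t)))
     = (\<lambda>t. ennreal (\<alpha> powr (s - 1)) * (if 0 < t then ennreal (exp (- \<alpha> * t) *
         t powr (s - 1)) else 0))"
  proof
    fix t
    show "ennreal (indicator {0..} (0 + \<alpha> * t) * (0 + \<alpha> * t) powr (s - 1) / exp (0 + \<alpha> * t))
       = ennreal (\<alpha> powr (s - 1)) * (if 0 < t then ennreal (exp (- \<alpha> * t) * t powr (s - 1)) else 0)"
      using assms by (auto simp: indicator_def powr_mult ennreal_mult[symmetric] exp_minus
          field_simps zero_le_mult_iff)
  qed
  also have "ennreal \<bar>\<alpha>\<bar> * (\<integral>\<^sup>+t. ennreal (\<alpha> powr (s - 1)) * (if 0 < t then ennreal (exp (- \<alpha> *
      t) * t powr (s - 1)) else 0) \<partial>lborel)
     = ennreal (\<alpha> powr s) * (\<integral>\<^sup>+t. (if 0 < t then ennreal (exp (- \<alpha> * t) *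
         t powr (s - 1)) else 0) \<partial>lborel)"
    using assms by (subst nn_integral_cmult)
      (auto simp: mult.assoc[symmetric] ennreal_mult[symmetric] powr_mult_base)
  finally have "ennreal (Gamma s) / ennreal (\<alpha> powr s) = ennreal (\<alpha> powr s) *
      (\<integral>\<^sup>+t. (if 0 < t then ennreal (exp (- \<alpha> * t) *
      t powr (s - 1)) else 0) \<partial>lborel) / ennreal (\<alpha> powr s)"
    by simp
  also have "\<dots> = (\<integral>\<^sup>+t. (if 0 < t then ennreal (exp (- \<alpha> * t) * t powr (s - 1)) else 0) \<partial>lborel)"
    using assms by (subst mult.commute, subst ennreal_mult_divide_eq) auto
  finally show ?thesis using assms by (simp add: divide_ennreal Gamma_real_pos less_imp_le)
qed

text \<open>The function \<open>c\<close> is not required to be measurable, so \<open>nn_integral_add\<close> does not apply to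
  \<open>c + m\<close>; instead the measurable difference \<open>f - m\<close> is compared with \<open>c\<close>.\<close>

lemma nn_integral_le_add:
  assumes [measurable]: "f \<in> borel_measurable M" "m \<in> borel_measurable M"
    and le: "AE x in M. f x \<le> c x + m x"
  shows "(\<integral>\<^sup>+x. f x \<partial>M) \<le> (\<integral>\<^sup>+x. c x \<partial>M) + (\<integral>\<^sup>+x. m x \<partial>M)"
proof -
  define d where "d x = (if m x = \<infinity> then 0 else f x - m x)" for x
  have [measurable]: "d \<in> borel_measurable M" unfolding d_def by measurable
  have "(\<integral>\<^sup>+x. f x \<partial>M) \<le> (\<integral>\<^sup>+x. d x + m x \<partial>M)"
  proof (rule nn_integral_mono)
    fix x
    show "f x \<le> d x + m x"
      using ennreal_minus_le_iff[of "f x" "m x" "f x - m x"] by (auto simp: d_def add.commute)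
  qed
  also have "\<dots> = (\<integral>\<^sup>+x. d x \<partial>M) + (\<integral>\<^sup>+x. m x \<partial>M)" by (rule nn_integral_add) measurable
  also have "(\<integral>\<^sup>+x. d x \<partial>M) \<le> (\<integral>\<^sup>+x. c x \<partial>M)"
    by (rule nn_integral_mono_AE, use le in eventually_elim) (auto simp: d_def
        ennreal_minus_le_iff add.commute)
  finally show ?thesis by simp
qed

text \<open>The assumption on \<open>A\<close> says that \<open>b + a y + c y\<^sup>2 < A y\<close> for some \<open>y = M > 0\<close>. A continuous
  function starting at \<open>0\<close> and obeying the reverse inequality cannot cross the level \<open>M\<close>.\<close>

lemma quadratic_barrier:
  fixes y :: "real \<Rightarrow> real"
  assumes nn: "a \<ge> 0" "b \<ge> 0" "c \<ge> 0"
    and gap: "A > a + 2 * sqrt (c * b)"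
    and cont: "\<And>T. continuous_on {t0..T} y" and init: "y t0 = 0"
    and ineq: "\<And>t. t \<ge> t0 \<Longrightarrow> A * y t \<le> b + a * y t + c * (y t)\<^sup>2"
  shows "\<exists>M\<ge>0. \<forall>t\<ge>t0. y t \<le> M"
proof (cases "c = 0")
  case True
  with gap have d: "A - a > 0" by simp
  have "y t \<le> b / (A - a)" if "t \<ge> t0" for t
    using ineq[OF that] True d by (simp add: field_simps)
  then show ?thesis using d nn by (intro exI[of _ "b / (A - a)"]) auto
next
  case False
  with nn have c: "c > 0" by simp
  define d where "d = A - a"
  have d: "d > 2 * sqrt (c * b)" using gap by (simp add: d_def)
  have d0: "d > 0" using d nn by (smt (verit) real_sqrt_ge_zero mult_nonneg_nonneg)
  have "(2 * sqrt (c * b))\<^sup>2 < d\<^sup>2" using d nn by (intro power_strict_mono) auto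
  then have d2: "4 * (c * b) < d\<^sup>2" using nn by (simp add: power_mult_distrib)
  \<comment> \<open>the point where \<open>d * y - c * y\<^sup>2\<close> is largest\<close>
  define M where "M = d / (2 * c)"
  have M: "M > 0" using d0 c by (simp add: M_def)
  have ne: "y t \<noteq> M" if "t \<ge> t0" for t
  proof
    assume "y t = M"
    with ineq[OF that] have "d * M \<le> b + c * M\<^sup>2" by (simp add: d_def algebra_simps)
    then have "d\<^sup>2 \<le> 4 * (c * b)" using c by (simp add: M_def field_simps power2_eq_square)
    with d2 show False by simp
  qed
  have "y t \<le> M" if "t \<ge> t0" for t
  proof (rule ccontr)
    assume "\<not> y t \<le> M"
    then have "\<exists>x. t0 \<le> x \<and> x \<le> t \<and> y x = M"
      using cont[of t] init M that by (intro IVT') auto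
    then obtain x where "x \<ge> t0" "y x = M" by blast
    with ne show False by blast
  qed
  then show ?thesis using M by (intro exI[of _ M]) auto
qed

text \<open>The scalar form of the argument. The tail of \<open>u\<close> beyond \<open>q0\<close> satisfies a quadratic integral
  inequality with kernel \<open>(q - q') powr (- \<beta>)\<close>; the truncated Laplace transforms
  \<open>Y L = \<integral>\<^bsub>q0\<^esub>\<^bsup>L\<^esup> exp (- \<alpha> q) u(q) dq\<close> are finite because \<open>u\<close> has some finite exponential moment,
  and depend continuously on \<open>L\<close>. They satisfy the quadratic inequality of \<open>quadratic_barrier\<close>, since
  the weight \<open>exp (- \<alpha> q)\<close> turns convolutions into products and the kernel into a Gamma
  integral. The function \<open>us\<close> need not be measurable.\<close>

lemma laplace_bootstrap:
  fixes u us :: "real \<Rightarrow> ennreal" and V S :: ennreal and q0 \<alpha> \<beta> :: real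
  defines "w \<equiv> \<lambda>q. ennreal (exp (- \<alpha> * q))"
  defines "ua \<equiv> \<lambda>q. if q \<le> q0 then u q else 0"
    and "ub \<equiv> \<lambda>q. if q0 < q then u q else 0"
  defines "h \<equiv> \<lambda>q. 2 * V * ub q + nconv ub u q + nconv ua ub q"
  assumes [measurable]: "u \<in> borel_measurable borel"
    and u0: "\<And>q. q \<le> 0 \<Longrightarrow> u q = 0" and q0: "q0 > 0" and \<alpha>: "\<alpha> > 0" and \<beta>: "\<beta> < 1"
    and fin: "(\<integral>\<^sup>+q. ennreal (exp (- \<alpha>' * q)) * u q \<partial>lborel) < \<infinity>"
    and ineq: "AE q in lborel. q0 < q \<longrightarrow> u q \<le> us q +
        2 * S * (\<integral>\<^sup>+q'. (if q0 < q' \<and> q' < q then ennreal ((q - q') powr (- \<beta>)) else 0) *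
            h q' \<partial>lborel)"
    and b_fin: "(\<integral>\<^sup>+q\<in>{q0<..}. (w q * us q) \<partial>lborel) < \<infinity>"
    and gap: "ennreal (\<alpha> powr (1 - \<beta>)) > 
        ennreal (Gamma (1 - \<beta>)) * (4 * S * V + 4 * S * (\<integral>\<^sup>+q\<in>{0<..q0}. (w q * u q) \<partial>lborel)) +
        2 * enn_sqrt (ennreal (Gamma (1 - \<beta>)) * (2 * S) * (ennreal (\<alpha> powr (1 - \<beta>)) *
            (\<integral>\<^sup>+q\<in>{q0<..}. (w q * us q) \<partial>lborel)))"
    and Sfin: "S < \<infinity>"
  shows "(\<integral>\<^sup>+q. w q * u q \<partial>lborel) < \<infinity>"
proof -
  have [measurable]: "ua \<in> borel_measurable borel" "ub \<in> borel_measurable borel" "w \<in>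
      borel_measurable borel"
    unfolding ua_def ub_def w_def by measurable
  have [measurable]: "h \<in> borel_measurable borel" unfolding h_def by measurable
  define A where "A = \<alpha> powr (1 - \<beta>)"
  define \<Gamma> where "\<Gamma> = Gamma (1 - \<beta>)"
  have \<Gamma>: "\<Gamma> > 0" using \<beta> by (simp add: \<Gamma>_def Gamma_real_pos)
  have A: "A > 0" using \<alpha> by (simp add: A_def)
  define Y where "Y L = (\<integral>\<^sup>+q\<in>{q0<..L}. (w q * u q) \<partial>lborel)" for L
  define A0 where "A0 = (\<integral>\<^sup>+q\<in>{0<..q0}. (w q * u q) \<partial>lborel)"
  define b0 where "b0 = (\<integral>\<^sup>+q\<in>{q0<..}. (w q * us q) \<partial>lborel)"
  have wfin: "(\<integral>\<^sup>+q\<in>{..L}. (w q * u q) \<partial>lborel) < \<infinity>" for L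
  proof -
    define m where "m = \<bar>\<alpha>' - \<alpha>\<bar> * \<bar>L\<bar>"
    have "w q * u q * indicator {..L} q \<le> ennreal (exp m) * (ennreal (exp (- \<alpha>' * q)) * u q)" for q
    proof (cases "0 < q \<and> q \<le> L")
      case True
      have "(\<alpha>' - \<alpha>) * q \<le> \<bar>\<alpha>' - \<alpha>\<bar> * \<bar>L\<bar>" using True by (intro mult_mono) auto
      then have "exp (- \<alpha> * q) \<le> exp m * exp (- \<alpha>' * q)"
        by (simp add: m_def exp_add[symmetric] algebra_simps)
      then have "w q \<le> ennreal (exp m) * ennreal (exp (- \<alpha>' * q))"
        unfolding w_def by (simp add: ennreal_mult[symmetric])
      then show ?thesis using True by (auto simp: indicator_def mult.assoc[symmetric] intro!:
          mult_right_mono)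
    qed (use u0 in \<open>auto simp: indicator_def not_less\<close>)
    then have "(\<integral>\<^sup>+q\<in>{..L}. (w q * u q) \<partial>lborel) \<le> (\<integral>\<^sup>+q. ennreal (exp m) * (ennreal (exp (- \<alpha>' *
        q)) * u q) \<partial>lborel)"
      by (intro nn_integral_mono)
    also have "\<dots> < \<infinity>" using fin by (subst nn_integral_cmult) (auto simp: ennreal_mult_less_top)
    finally show ?thesis .
  qed
  have A0fin: "A0 < \<infinity>" unfolding A0_def
    by (rule order.strict_trans1[OF _ wfin[of q0]], intro nn_integral_mono) (auto simp:
        indicator_def)
  have Yfin: "Y L < \<infinity>" for L unfolding Y_def
    by (rule order.strict_trans1[OF _ wfin[of L]], intro nn_integral_mono) (auto simp:
        indicator_def)
  have split: "(\<integral>\<^sup>+q\<in>{..L}. (w q * u q) \<partial>lborel) \<le> A0 + Y L" for L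
    unfolding A0_def Y_def
    by (subst nn_integral_add[symmetric], simp, simp, intro nn_integral_mono)
       (use u0 in \<open>auto simp: indicator_def not_less not_le\<close>)
  \<comment> \<open>truncation at \<open>L\<close> is compatible with convolution of functions living on the positive half-line\<close>
  have conv_le: "(\<integral>\<^sup>+y\<in>{q0<..L}. (w y * nconv f g y) \<partial>lborel) \<le>
      (\<integral>\<^sup>+y\<in>{..L}. (w y * f y) \<partial>lborel) * (\<integral>\<^sup>+y\<in>{..L}. (w y * g y) \<partial>lborel)"
    if [measurable]: "f \<in> borel_measurable borel" "g \<in> borel_measurable borel"
      and f0: "\<And>q. q \<le> 0 \<Longrightarrow> f q = 0" and g0: "\<And>q. q \<le> 0 \<Longrightarrow> g q = 0" for f g L
  proof -
    have "w y * nconv f g y * indicator {q0<..L} y \<le>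
        nconv (\<lambda>y. w y * f y * indicator {..L} y) (\<lambda>y. w y * g y * indicator {..L} y) y" for y
    proof (cases "y \<le> L")
      case True
      have "w y * nconv f g y = nconv (\<lambda>y. w y * f y) (\<lambda>y. w y * g y) y"
        unfolding w_def by (rule exp_weight_nconv) measurable
      also have "\<dots> \<le> nconv (\<lambda>y. w y * f y * indicator {..L} y) (\<lambda>y. w y * g y *
          indicator {..L} y) y"
        unfolding nconv_def
      proof (rule nn_integral_mono)
        fix p
        show "w p * f p * (w (y - p) * g (y - p)) \<le>
          w p * f p * indicator {..L} p * (w (y - p) * g (y - p) * indicator {..L} (y - p))"
        proof (cases "0 < p \<and> 0 < y - p")
          case True
          with \<open>y \<le> L\<close> show ?thesis by (auto simp: indicator_def)
        next
          case False
          then have "f p = 0 \<or> g (y - p) = 0" using f0[of p] g0[of "y - p"] by (auto simp: not_less)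
          then show ?thesis by auto
        qed
      qed
      finally show ?thesis by (auto simp: indicator_def)
    qed (auto simp: indicator_def)
    then have "(\<integral>\<^sup>+y\<in>{q0<..L}. (w y * nconv f g y) \<partial>lborel) \<le>
      (\<integral>\<^sup>+y. nconv (\<lambda>y. w y * f y * indicator {..L} y) (\<lambda>y. w y * g y *
          indicator {..L} y) y \<partial>lborel)"
      by (intro nn_integral_mono)
    also have "\<dots> = (\<integral>\<^sup>+y\<in>{..L}. (w y * f y) \<partial>lborel) * (\<integral>\<^sup>+y\<in>{..L}. (w y * g y) \<partial>lborel)"
      by (rule nn_integral_nconv) measurable
    finally show ?thesis .
  qed
  have ub_Y: "(\<integral>\<^sup>+y\<in>{..L}. (w y * ub y) \<partial>lborel) = Y L" for L
    unfolding Y_def ub_def by (intro nn_integral_cong) (auto simp: indicator_def)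
  have ua_A0: "(\<integral>\<^sup>+y\<in>{..L}. (w y * ua y) \<partial>lborel) \<le> A0" for L
    unfolding A0_def ua_def by (intro nn_integral_mono) (use u0 in \<open>auto simp: indicator_def
        not_le\<close>)
  have H: "(\<integral>\<^sup>+y\<in>{q0<..L}. (w y * h y) \<partial>lborel) \<le> 2 * V * Y L + Y L * (A0 + Y L) + A0 * Y L" for L
  proof -
    have "(\<integral>\<^sup>+y\<in>{q0<..L}. (w y * h y) \<partial>lborel) =
      (\<integral>\<^sup>+y. 2 * V * (w y * ub y * indicator {q0<..L} y) + (w y * nconv ub u y *
          indicator {q0<..L} y
         + w y * nconv ua ub y * indicator {q0<..L} y) \<partial>lborel)"
      by (intro nn_integral_cong) (simp add: h_def algebra_simps)
    also have "\<dots> = 2 * V * (\<integral>\<^sup>+y\<in>{q0<..L}. (w y * ub y) \<partial>lborel) + ((\<integral>\<^sup>+y\<in>{q0<..L}. (w y *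
        nconv ub u y) \<partial>lborel) +
        (\<integral>\<^sup>+y\<in>{q0<..L}. (w y * nconv ua ub y) \<partial>lborel))"
      by (simp add: nn_integral_add nn_integral_cmult)
    also have "\<dots> \<le> 2 * V * Y L + (Y L * (A0 + Y L) + A0 * Y L)"
    proof (intro add_mono mult_left_mono)
      show "(\<integral>\<^sup>+y\<in>{q0<..L}. (w y * ub y) \<partial>lborel) \<le> Y L"
        unfolding Y_def ub_def by (intro nn_integral_mono) (auto simp: indicator_def)
      show "(\<integral>\<^sup>+y\<in>{q0<..L}. (w y * nconv ub u y) \<partial>lborel) \<le> Y L * (A0 + Y L)"
        by (rule order_trans[OF conv_le]) (use u0 q0 split ub_Y in \<open>auto simp: ub_def intro!:
            mult_mono\<close>)
      show "(\<integral>\<^sup>+y\<in>{q0<..L}. (w y * nconv ua ub y) \<partial>lborel) \<le> A0 * Y L"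
        by (rule order_trans[OF conv_le]) (use u0 q0 ua_A0 ub_Y in \<open>auto simp: ub_def ua_def
            intro!: mult_mono\<close>)
    qed auto
    finally show ?thesis by (simp add: add.assoc)
  qed
  define K where "K q = (\<integral>\<^sup>+q'. (if q0 < q' \<and> q' < q then ennreal ((q - q') powr (- \<beta>)) else 0) *
      h q' \<partial>lborel)" for q
  have [measurable]: "K \<in> borel_measurable borel" unfolding K_def by measurable
  have KK: "(\<integral>\<^sup>+q\<in>{q0<..L}. (w q * K q) \<partial>lborel) \<le> ennreal (\<Gamma> / A) * (\<integral>\<^sup>+y\<in>{q0<..L}. (w y *
      h y) \<partial>lborel)" for L
  proof -
    define g where "g t = (if 0 < t then ennreal (exp (- \<alpha> * t) * t powr (- \<beta>)) else 0)" for t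
    have [measurable]: "g \<in> borel_measurable borel" unfolding g_def by measurable
    have gi: "(\<integral>\<^sup>+t. g t \<partial>lborel) = ennreal (\<Gamma> / A)"
    proof -
      have "1 - \<beta> - 1 = - \<beta>" by simp
      from nn_integral_exp_powr[of "1 - \<beta>" \<alpha>, unfolded this] show ?thesis
        using \<alpha> \<beta> by (simp add: g_def \<Gamma>_def A_def)
    qed
    have "w q * K q * indicator {q0<..L} q \<le> nconv (\<lambda>y. w y * h y * indicator {q0<..L} y) g q" for q
    proof (cases "q0 < q \<and> q \<le> L")
      case True
      have "w q * K q = (\<integral>\<^sup>+q'. w q * ((if q0 < q' \<and> q' < q then ennreal ((q - q') powr (- \<beta>))
          else 0) * h q') \<partial>lborel)"
        unfolding K_def by (rule nn_integral_cmult[symmetric]) measurable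
      also have "\<dots> \<le> nconv (\<lambda>y. w y * h y * indicator {q0<..L} y) g q"
        unfolding nconv_def
      proof (rule nn_integral_mono)
        fix p
        show "w q * ((if q0 < p \<and> p < q then ennreal ((q - p) powr (- \<beta>)) else 0) * h p) \<le>
           w p * h p * indicator {q0<..L} p * g (q - p)"
        proof (cases "q0 < p \<and> p < q")
          case p: True
          have "w q * ennreal ((q - p) powr (- \<beta>)) = w p * g (q - p)"
            unfolding w_def g_def using p
            by (simp add: ennreal_mult[symmetric] mult.assoc[symmetric] exp_add[symmetric]
                algebra_simps)
          then have "w q * (ennreal ((q - p) powr (- \<beta>)) * h p) = w p * h p * g (q - p)"
            by (metis mult.assoc mult.commute)
          with p True show ?thesis by (auto simp: indicator_def)
        qed auto
      qed
      finally show ?thesis using True by (simp add: indicator_def)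
    qed (auto simp: indicator_def)
    then have "(\<integral>\<^sup>+q\<in>{q0<..L}. (w q * K q) \<partial>lborel) \<le> (\<integral>\<^sup>+q. nconv (\<lambda>y. w y * h y *
        indicator {q0<..L} y) g q \<partial>lborel)"
      by (intro nn_integral_mono)
    also have "\<dots> = (\<integral>\<^sup>+y\<in>{q0<..L}. (w y * h y) \<partial>lborel) * ennreal (\<Gamma> / A)"
      by (subst nn_integral_nconv) (simp_all add: gi)
    finally show ?thesis by (simp add: mult.commute)
  qed
  have Yineq: "Y L \<le> b0 + 2 * S * (ennreal (\<Gamma> / A) * (2 * V * Y L + Y L * (A0 + Y L) + A0 *
      Y L))" for L
  proof -
    have "Y L \<le> b0 + (\<integral>\<^sup>+q. 2 * S * (w q * K q * indicator {q0<..L} q) \<partial>lborel)"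
      unfolding Y_def b0_def
    proof (rule nn_integral_le_add)
      show "AE q in lborel. w q * u q * indicator {q0<..L} q \<le> w q * us q * indicator {q0<..} q +
          2 * S * (w q * K q * indicator {q0<..L} q)"
        using ineq
      proof eventually_elim
        case (elim q)
        show ?case
        proof (cases "q0 < q \<and> q \<le> L")
          case True
          with elim have "w q * u q \<le> w q * (us q + 2 * S * K q)"
              by (auto simp: K_def intro!: mult_left_mono)
          with True show ?thesis by (simp add: indicator_def algebra_simps)
        qed (auto simp: indicator_def)
      qed
    qed measurable
    also have "\<dots> = b0 + 2 * S * (\<integral>\<^sup>+q\<in>{q0<..L}. (w q * K q) \<partial>lborel)"
      by (simp add: nn_integral_cmult)
    also have "\<dots> \<le> b0 + 2 * S * (ennreal (\<Gamma> / A) * (2 * V * Y L + Y L * (A0 + Y L) + A0 * Y L))"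
      by (intro add_left_mono mult_left_mono order_trans[OF KK] H) auto
    finally show ?thesis .
  qed
  define e1 where "e1 = ennreal \<Gamma> * (4 * S * V + 4 * S * A0)"
  define e where "e = ennreal \<Gamma> * (2 * S)"
  define b where "b = ennreal A * b0"
  have gap': "ennreal A > e1 + 2 * enn_sqrt (e * b)"
    using gap unfolding A_def \<Gamma>_def e1_def e_def b_def A0_def b0_def .
  have "e1 \<le> e1 + 2 * enn_sqrt (e * b)" by simp
  also note gap'
  also have "ennreal A < \<infinity>" by simp
  finally have e1fin: "e1 < \<infinity>" .
  have efin: "e < \<infinity>" using Sfin by (simp add: e_def ennreal_mult_less_top)
  have bfin: "b < \<infinity>" using b_fin by (simp add: b_def b0_def ennreal_mult_less_top)
  have YA: "ennreal A * Y L \<le> b + e1 * Y L + e * (Y L)\<^sup>2" for L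
  proof -
    have "ennreal A * Y L \<le> ennreal A * (b0 + 2 * S * (ennreal (\<Gamma> / A) * (2 * V * Y L + Y L *
        (A0 + Y L) + A0 * Y L)))"
      by (intro mult_left_mono Yineq) auto
    also have "\<dots> = b + 2 * S * ((ennreal A * ennreal (\<Gamma> / A)) * (2 * V * Y L + Y L * (A0 + Y L) +
        A0 * Y L))"
      by (simp add: b_def algebra_simps)
    also have "ennreal A * ennreal (\<Gamma> / A) = ennreal \<Gamma>"
      using A \<Gamma> by (simp add: ennreal_mult[symmetric])
    also have "b + 2 * S * (ennreal \<Gamma> * (2 * V * Y L + Y L * (A0 + Y L) + A0 * Y L)) = b + e1 *
        Y L + e * (Y L)\<^sup>2"
      unfolding e1_def e_def by (simp add: algebra_simps power2_eq_square numeral_Bit0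
          one_add_one[symmetric] del: one_add_one)
    finally show ?thesis .
  qed
  obtain re1 re rb where r: "e1 = ennreal re1" "e = ennreal re" "b =
      ennreal rb" "re1 \<ge> 0" "re \<ge> 0" "rb \<ge> 0"
    using e1fin efin bfin by (intro that[of "enn2real e1" "enn2real e" "enn2real b"]) auto
  define y where "y L = enn2real (Y L)" for L
  have Yy: "Y L = ennreal (y L)" "y L \<ge> 0" for L
    using Yfin[of L] by (auto simp: y_def)
  have "e * b = ennreal (re * rb)" using r by (simp add: ennreal_mult)
  then have "enn_sqrt (e * b) = ennreal (sqrt (re * rb))"
    using r by (simp add: enn_sqrt_def)
  with gap' r have "ennreal (re1 + 2 * sqrt (re * rb)) < ennreal A"
    by (simp add: ennreal_plus ennreal_mult)
  then have gapr: "re1 + 2 * sqrt (re * rb) < A"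
    using r by (simp add: ennreal_less_iff del: ennreal_plus)
  have ineqr: "A * y L \<le> rb + re1 * y L + re * (y L)\<^sup>2" for L
  proof -
    have "ennreal (A * y L) \<le> ennreal (rb + re1 * y L + re * (y L)\<^sup>2)"
      using YA[of L] r A Yy[of L] by (simp add: ennreal_mult ennreal_plus ennreal_power)
    then show ?thesis using r Yy[of L] by (simp add: ennreal_le_iff del: ennreal_plus)
  qed
  have y0: "y q0 = 0" by (simp add: y_def Y_def)
  have cont: "continuous_on {q0..T} y" for T
  proof -
    define g where "g q = enn2real (w q * u q)" for q
    have [measurable]: "g \<in> borel_measurable borel" unfolding g_def by measurable
    have ae: "AE q in lborel. ennreal (g q) = w q * u q"
    proof -
      have "AE q in lborel. ennreal (exp (- \<alpha>' * q)) * u q \<noteq> \<infinity>"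
        using fin by (intro nn_integral_PInf_AE) auto
      then show ?thesis
      proof eventually_elim
        case (elim q)
        then have "u q < \<infinity>" by (auto simp: ennreal_mult_eq_top_iff less_top)
        then show ?case by (simp add: g_def w_def ennreal_mult_less_top)
      qed
    qed
    have nn: "(\<integral>\<^sup>+q. ennreal (indicator {q0..L} q * g q) \<partial>lborel) = Y L" for L
      unfolding Y_def
    proof (rule nn_integral_cong_AE, use ae AE_lborel_singleton[of q0] in eventually_elim)
      case (elim q)
      then show ?case by (auto simp: indicator_def)
    qed
    have gn: "g q \<ge> 0" for q by (simp add: g_def)
    have int: "integrable lborel (\<lambda>q. indicator {q0..L} q * g q)" for L
      using Yfin[of L] by (intro integrableI_nonneg) (auto simp: nn gn)
    have "set_integrable lborel {q0..L} g" for L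
      using int[of L] by (simp add: set_integrable_def)
    note hk = set_borel_integral_eq_integral[OF this]
    have yI: "y L = integral {q0..L} g" for L
    proof -
      have "integral {q0..L} g = (LINT q|lborel. indicator {q0..L} q * g q)"
        using hk(2)[of L] by (simp add: set_lebesgue_integral_def)
      also have "\<dots> = enn2real (Y L)"
        using gn by (subst integral_eq_nn_integral) (auto simp: nn)
      finally show ?thesis by (simp add: y_def)
    qed
    show ?thesis
      unfolding yI[abs_def] by (rule indefinite_integral_continuous_1[OF hk(1)])
  qed
  obtain M where M: "M \<ge> 0" "\<And>t. t \<ge> q0 \<Longrightarrow> y t \<le> M"
    using quadratic_barrier[OF r(4,6,5) gapr cont y0] ineqr by blast
  have "(\<integral>\<^sup>+q\<in>{q0<..}. (w q * u q) \<partial>lborel) = (\<integral>\<^sup>+q. (SUP n::nat. w q * u q *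
      indicator {q0<..q0 + real n} q) \<partial>lborel)"
  proof (rule nn_integral_cong)
    fix q
    obtain n0 :: nat where n0: "q \<le> q0 + real n0" using real_arch_simple[of "q - q0"]
        by (auto simp: algebra_simps)
    have "w q * u q * indicator {q0<..} q \<le> w q * u q * indicator {q0<..q0 + real n0} q"
      using n0 by (auto simp: indicator_def)
    also have "\<dots> \<le> (SUP n::nat. w q * u q * indicator {q0<..q0 + real n} q)"
        by (rule SUP_upper) simp
    finally show "w q * u q * indicator {q0<..} q = (SUP n::nat. w q * u q * indicator {q0<..q0 +
        real n} q)"
      by (intro antisym SUP_least) (auto simp: indicator_def)
  qed
  also have "\<dots> = (SUP n::nat. Y (q0 + real n))"
    unfolding Y_def
    by (rule nn_integral_monotone_convergence_SUP)
       (auto simp: incseq_def le_fun_def indicator_def)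
  also have "\<dots> \<le> ennreal M"
    using M by (intro SUP_least) (simp add: Yy ennreal_leI)
  finally have tail: "(\<integral>\<^sup>+q\<in>{q0<..}. (w q * u q) \<partial>lborel) < \<infinity>" by (simp add: order.strict_trans1)
  have "(\<integral>\<^sup>+q. w q * u q \<partial>lborel) = (\<integral>\<^sup>+q. w q * u q * indicator {..q0} q + w q * u q *
      indicator {q0<..} q \<partial>lborel)"
    by (intro nn_integral_cong) (auto simp: indicator_def)
  also have "\<dots> = (\<integral>\<^sup>+q\<in>{..q0}. (w q * u q) \<partial>lborel) + (\<integral>\<^sup>+q\<in>{q0<..}. (w q * u q) \<partial>lborel)"
    by (rule nn_integral_add) measurable
  also have "\<dots> < \<infinity>" using tail wfin[of q0] by simp
  finally show ?thesis .
qed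

section \<open>Comparison of the nonlinear terms\<close>

lemma fconv_eq_integral: "fconv a b k = (LINT l|count_space UNIV. a l *s b (k - l))"
  by (simp add: fconv_def infsum_eq_integral_count_space)

lemma flconv_eq_integral: "flconv a b k q = (LINT l|count_space UNIV. lconv (a l) (b (k - l)) q)"
  by (simp add: flconv_def infsum_eq_integral_count_space)

lemma lconv_eq_integral:
  assumes "\<And>p. p \<le> 0 \<Longrightarrow> a p = 0" "\<And>p. p \<le> 0 \<Longrightarrow> b p = 0"
  shows "lconv a b q = (LINT p|lborel. a p *s b (q - p))"
  unfolding lconv_def set_lebesgue_integral_def
proof (rule Bochner_Integration.integral_cong)
  fix p
  show "indicator {0..q} p *\<^sub>R (a p *s b (q - p)) = a p *s b (q - p)"
    using assms(1)[of p] assms(2)[of "q - p"]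
    by (cases "p < 0"; cases "p > q") (auto simp: indicator_def vec_eq_iff)
qed simp

text \<open>The values at \<open>0\<close> enter the convolution only at the endpoints of the interval, a null set.\<close>

lemma lconv_cong:
  assumes "\<And>p. p > 0 \<Longrightarrow> a p = a' p" "\<And>p. p > 0 \<Longrightarrow> b p = b' p"
  shows "lconv a b q = lconv a' b' q"
  unfolding lconv_def set_lebesgue_integral_def
  by (rule integral_discrete_difference[where X="{0, q}"]) (use assms in \<open>auto simp: indicator_def\<close>)

lemma H_hat_cong:
  assumes "q > 0" "\<And>k p. p > 0 \<Longrightarrow> X k p = X' k p"
  shows "H_hat v X j k q = H_hat v X' j k q"
proof -
  have "lconv (\<lambda>p. X l p $ j) (X (k - l)) q = lconv (\<lambda>p. X' l p $ j) (X' (k - l)) q" for l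
    by (rule lconv_cong) (use assms in auto)
  then show ?thesis using assms by (simp add: H_hat_def flconv_def)
qed

lemma borel_measurable_leray:
  assumes [measurable]: "f \<in> borel_measurable M"
  shows "(\<lambda>x. leray k (f x)) \<in> borel_measurable M"
  unfolding leray_def by measurable

lemma borel_measurable_H_hat:
  assumes [measurable]: "\<And>k. X k \<in> borel_measurable borel"
    and X0: "\<And>k p. p \<le> 0 \<Longrightarrow> X k p = 0"
  shows "H_hat v X j k \<in> borel_measurable borel"
proof -
  have [measurable]: "(\<lambda>q. fconv (\<lambda>l. v l $ j) (\<lambda>l. X l q) k) \<in> borel_measurable borel"
    unfolding fconv_def by (rule borel_measurable_infsum) measurable
  have [measurable]: "(\<lambda>q. fconv (\<lambda>l. X l q $ j) v k) \<in> borel_measurable borel"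
    unfolding fconv_def by (rule borel_measurable_infsum) measurable
  have "(\<lambda>q. LINT p|lborel. X l p $ j *s X m (q - p)) \<in> borel_measurable borel" for l m
    by (rule lborel.borel_measurable_lebesgue_integral) measurable
  then have "(\<lambda>q. lconv (\<lambda>p. X l p $ j) (X m) q) \<in> borel_measurable borel" for l m
    by (subst lconv_eq_integral) (auto simp: X0)
  then have [measurable]: "(\<lambda>q. flconv (\<lambda>l p. X l p $ j) X k q) \<in> borel_measurable borel"
    unfolding flconv_def by (rule borel_measurable_infsum)
  show ?thesis
    unfolding H_hat_def[abs_def] by (rule borel_measurable_leray) measurable
qed

lemma integrable_fconv:
  fixes a b :: "int^3 \<Rightarrow> complex^3"
  assumes "l1norm a < \<infinity>" "l1norm b < \<infinity>"
  shows "integrable (count_space UNIV) (\<lambda>l. a l $ j *s b (k - l))"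
proof (rule integrableI_bounded)
  have "(\<integral>\<^sup>+l. ennreal (norm (a l $ j *s b (k - l))) \<partial>count_space UNIV) \<le>
      (\<integral>\<^sup>+l. ennreal (norm (a l)) * l1norm b \<partial>count_space UNIV)"
    by (rule nn_integral_mono)
       (auto simp: norm_vector_scalar_mult ennreal_mult intro!: mult_mono norm_le_l1norm
           ennreal_leI Finite_Cartesian_Product.norm_nth_le)
  also have "\<dots> = l1norm a * l1norm b" by (simp add: nn_integral_multc l1norm_def)
  also have "\<dots> < \<infinity>" using assms by (simp add: ennreal_mult_less_top)
  finally show "(\<integral>\<^sup>+l. ennreal (norm (a l $ j *s b (k - l))) \<partial>count_space UNIV) < \<infinity>" .
qed simp

lemma nn_integral_flconv_le:
  fixes X Z :: "int^3 \<Rightarrow> real \<Rightarrow> complex^3"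
  assumes [measurable]: "\<And>k. X k \<in> borel_measurable borel" "\<And>k. Z k \<in> borel_measurable borel"
  shows "(\<integral>\<^sup>+l. \<integral>\<^sup>+p. ennreal (norm (X l p)) *
      ennreal (norm (Z (k - l) (q - p))) \<partial>lborel \<partial>count_space UNIV)
    \<le> nconv (\<lambda>q. l1norm (\<lambda>k. X k q)) (\<lambda>q. l1norm (\<lambda>k. Z k q)) q"
proof -
  have "(\<integral>\<^sup>+l. \<integral>\<^sup>+p. ennreal (norm (X l p)) * ennreal (norm (Z (k - l) (q - p))) \<partial>lborel
      \<partial>count_space UNIV)
     = (\<integral>\<^sup>+p. \<integral>\<^sup>+l. ennreal (norm (X l p)) * ennreal (norm (Z (k - l) (q - p))) \<partial>count_space UNIV
         \<partial>lborel)"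
    by (rule nn_integral_count_space_nn_integral[symmetric]) auto
  also have "\<dots> \<le> (\<integral>\<^sup>+p. l1norm (\<lambda>k. X k p) * l1norm (\<lambda>k. Z k (q - p)) \<partial>lborel)"
  proof (rule nn_integral_mono)
    fix p
    have "(\<integral>\<^sup>+l. ennreal (norm (X l p)) * ennreal (norm (Z (k - l) (q - p))) \<partial>count_space UNIV)
       \<le> (\<integral>\<^sup>+l. ennreal (norm (X l p)) * l1norm (\<lambda>k. Z k (q - p)) \<partial>count_space UNIV)"
      by (intro nn_integral_mono mult_left_mono norm_le_l1norm) auto
    then show "(\<integral>\<^sup>+l. ennreal (norm (X l p)) * ennreal (norm (Z (k - l) (q - p))) \<partial>count_space UNIV)
       \<le> l1norm (\<lambda>k. X k p) * l1norm (\<lambda>k. Z k (q - p))"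
      by (simp add: nn_integral_multc l1norm_def)
  qed
  finally show ?thesis unfolding nconv_def .
qed

lemma sum_dconv:
  fixes a b :: "int^3 \<Rightarrow> ennreal"
  shows "(\<integral>\<^sup>+k. \<integral>\<^sup>+l. a l * b (k - l) \<partial>count_space UNIV \<partial>count_space UNIV)
    = (\<integral>\<^sup>+l. a l \<partial>count_space UNIV) * (\<integral>\<^sup>+l. b l \<partial>count_space UNIV)"
proof -
  have "(\<integral>\<^sup>+k. \<integral>\<^sup>+l. a l * b (k - l) \<partial>count_space UNIV \<partial>count_space UNIV)
     = (\<integral>\<^sup>+l. \<integral>\<^sup>+k. a l * b (k - l) \<partial>count_space UNIV \<partial>count_space UNIV)"
    by (rule nn_integral_count_space_nn_integral) auto
  also have "\<dots> = (\<integral>\<^sup>+l. a l * (\<integral>\<^sup>+l. b l \<partial>count_space UNIV) \<partial>count_space UNIV)"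
    by (simp add: nn_integral_cmult nn_integral_count_space_shift)
  finally show ?thesis by (simp add: nn_integral_multc)
qed

lemma sum_flconv:
  fixes X Z :: "int^3 \<Rightarrow> real \<Rightarrow> complex^3"
  assumes [measurable]: "\<And>k. X k \<in> borel_measurable borel" "\<And>k. Z k \<in> borel_measurable borel"
  shows "(\<integral>\<^sup>+k. \<integral>\<^sup>+l. \<integral>\<^sup>+p. ennreal (norm (X l p)) *
      ennreal (norm (Z (k - l) (q - p))) \<partial>lborel \<partial>count_space UNIV \<partial>count_space UNIV)
    = nconv (\<lambda>q. l1norm (\<lambda>k. X k q)) (\<lambda>q. l1norm (\<lambda>k. Z k q)) q"
proof -
  have "(\<integral>\<^sup>+k. \<integral>\<^sup>+l. \<integral>\<^sup>+p. ennreal (norm (X l p)) *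
      ennreal (norm (Z (k - l) (q - p))) \<partial>lborel \<partial>count_space UNIV \<partial>count_space UNIV)
    = (\<integral>\<^sup>+k. \<integral>\<^sup>+p. \<integral>\<^sup>+l. ennreal (norm (X l p)) *
        ennreal (norm (Z (k - l) (q - p))) \<partial>count_space UNIV \<partial>lborel \<partial>count_space UNIV)"
    by (intro nn_integral_cong nn_integral_count_space_nn_integral[symmetric]) auto
  also have "\<dots> = (\<integral>\<^sup>+p. \<integral>\<^sup>+k. \<integral>\<^sup>+l. ennreal (norm (X l p)) *
      ennreal (norm (Z (k - l) (q - p))) \<partial>count_space UNIV \<partial>count_space UNIV \<partial>lborel)"
    by (intro nn_integral_count_space_nn_integral[symmetric]
        borel_measurable_nn_integral_count_space) auto
  also have "\<dots> = (\<integral>\<^sup>+p. l1norm (\<lambda>k. X k p) * l1norm (\<lambda>k. Z k (q - p)) \<partial>lborel)"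
    unfolding l1norm_def by (intro nn_integral_cong sum_dconv)
  finally show ?thesis unfolding nconv_def .
qed

text \<open>The part of \<open>X\<close> beyond \<open>q0\<close>, complementary to \<open>Ua q0 X\<close>.\<close>

definition tail :: "real \<Rightarrow> (int^3 \<Rightarrow> real \<Rightarrow> complex^3) \<Rightarrow> int^3 \<Rightarrow> real \<Rightarrow> complex^3" where
  "tail q0 X k q = (if q0 < q then X k q else 0)"

text \<open>A majorant of the difference of the nonlinear terms of \<open>X\<close> and \<open>Ua q0 X\<close> at the wave vector
  \<open>k\<close>, with norms in place of vectors. Every summand has the tail of \<open>X\<close> as a factor: the
  quadratic part comes from \<open>X X' - Xa Xa' = Xb X' + Xa Xb'\<close>, where \<open>X = Xa + Xb\<close>.\<close>

definition Hdiff_bound ::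
  "(int^3 \<Rightarrow> complex^3) \<Rightarrow> real \<Rightarrow> (int^3 \<Rightarrow> real \<Rightarrow> complex^3) \<Rightarrow> int^3 \<Rightarrow> real \<Rightarrow> ennreal" where
  "Hdiff_bound v q0 X k q =
     (\<integral>\<^sup>+l. ennreal (norm (v l)) * ennreal (norm (tail q0 X (k - l) q)) \<partial>count_space UNIV) +
     (\<integral>\<^sup>+l. ennreal (norm (tail q0 X l q)) * ennreal (norm (v (k - l))) \<partial>count_space UNIV) +
     ((\<integral>\<^sup>+l. \<integral>\<^sup>+p. ennreal (norm (tail q0 X l p)) *
         ennreal (norm (X (k - l) (q - p))) \<partial>lborel \<partial>count_space UNIV) +
      (\<integral>\<^sup>+l. \<integral>\<^sup>+p. ennreal (norm (Ua q0 X l p)) *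
          ennreal (norm (tail q0 X (k - l) (q - p))) \<partial>lborel \<partial>count_space UNIV))"

lemma borel_measurable_tail [measurable]:
  assumes [measurable]: "X k \<in> borel_measurable borel"
  shows "tail q0 X k \<in> borel_measurable borel"
  unfolding tail_def[abs_def] by measurable

lemma borel_measurable_Ua [measurable]:
  assumes [measurable]: "X k \<in> borel_measurable borel"
  shows "Ua q0 X k \<in> borel_measurable borel"
  unfolding Ua_def[abs_def] by measurable

lemma borel_measurable_Hdiff_bound [measurable]:
  assumes [measurable]: "\<And>k. X k \<in> borel_measurable borel"
  shows "Hdiff_bound v q0 X k \<in> borel_measurable borel"
proof -
  have 1[measurable]: "(\<lambda>q. \<integral>\<^sup>+l. ennreal (norm (v l)) *
      ennreal (norm (tail q0 X (k - l) q)) \<partial>count_space UNIV) \<in> borel_measurable borel"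
    by (rule borel_measurable_nn_integral_count_space) measurable
  have 2[measurable]: "(\<lambda>q. \<integral>\<^sup>+l. ennreal (norm (tail q0 X l q)) *
      ennreal (norm (v (k - l))) \<partial>count_space UNIV) \<in> borel_measurable borel"
    by (rule borel_measurable_nn_integral_count_space) measurable
  have 3[measurable]: "(\<lambda>q. \<integral>\<^sup>+l. \<integral>\<^sup>+p. ennreal (norm (tail q0 X l p)) *
      ennreal (norm (X (k - l) (q - p))) \<partial>lborel \<partial>count_space UNIV) \<in> borel_measurable borel"
    by (rule borel_measurable_nn_integral_count_space) measurable
  have 4[measurable]: "(\<lambda>q. \<integral>\<^sup>+l. \<integral>\<^sup>+p. ennreal (norm (Ua q0 X l p)) *
      ennreal (norm (tail q0 X (k - l) (q - p))) \<partial>lborel \<partial>count_space UNIV) \<in> borel_measurable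
      borel"
    by (rule borel_measurable_nn_integral_count_space) measurable
  show ?thesis unfolding Hdiff_bound_def[abs_def] by measurable
qed

lemma l1norm_tail: "l1norm (\<lambda>k. tail q0 X k q) = (if q0 < q then l1norm (\<lambda>k. X k q) else 0)"
  by (simp add: tail_def l1norm_def)

lemma l1norm_Ua: "l1norm (\<lambda>k. Ua q0 X k q) = (if 0 < q \<and> q \<le> q0 then l1norm (\<lambda>k. X k q) else 0)"
  by (cases "0 < q \<and> q \<le> q0") (auto simp: Ua_def l1norm_def)

lemma sum_Hdiff_bound:
  assumes [measurable]: "\<And>k. X k \<in> borel_measurable borel"
  shows "(\<integral>\<^sup>+k. Hdiff_bound v q0 X k q \<partial>count_space UNIV) =
    2 * l1norm v * l1norm (\<lambda>k. tail q0 X k q) +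
    nconv (\<lambda>q. l1norm (\<lambda>k. tail q0 X k q)) (\<lambda>q. l1norm (\<lambda>k. X k q)) q +
    nconv (\<lambda>q. l1norm (\<lambda>k. Ua q0 X k q)) (\<lambda>q. l1norm (\<lambda>k. tail q0 X k q)) q"
proof -
  have "(\<integral>\<^sup>+k. Hdiff_bound v q0 X k q \<partial>count_space UNIV) =
     l1norm v * l1norm (\<lambda>k. tail q0 X k q) + l1norm (\<lambda>k. tail q0 X k q) * l1norm v +
    (nconv (\<lambda>q. l1norm (\<lambda>k. tail q0 X k q)) (\<lambda>q. l1norm (\<lambda>k. X k q)) q +
    nconv (\<lambda>q. l1norm (\<lambda>k. Ua q0 X k q)) (\<lambda>q. l1norm (\<lambda>k. tail q0 X k q)) q)"
    unfolding Hdiff_bound_def l1norm_def[of v] l1norm_def[of "\<lambda>k. tail q0 X k q"]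
    by (simp add: nn_integral_add sum_flconv
        sum_dconv[of "\<lambda>l. ennreal (norm (v l))" "\<lambda>l. ennreal (norm (tail q0 X l q))"]
        sum_dconv[of "\<lambda>l. ennreal (norm (tail q0 X l q))" "\<lambda>l. ennreal (norm (v l))"])
  then show ?thesis by (simp add: mult_2 algebra_simps)
qed

lemma norm_H_hat_diff_le:
  fixes X :: "int^3 \<Rightarrow> real \<Rightarrow> complex^3"
  assumes [measurable]: "\<And>k. X k \<in> borel_measurable borel"
    and X0: "\<And>k p. p \<le> 0 \<Longrightarrow> X k p = 0"
    and q0: "q0 > 0"
    and v: "l1norm v < \<infinity>" and fin: "l1norm (\<lambda>k. X k q) < \<infinity>"
    and fin2: "nconv (\<lambda>q. l1norm (\<lambda>k. X k q)) (\<lambda>q. l1norm (\<lambda>k. X k q)) q < \<infinity>"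
  shows "ennreal (norm (H_hat v X j k q - H_hat v (Ua q0 X) j k q)) \<le> Hdiff_bound v q0 X k q"
proof -
  let ?Z = "Ua q0 X" and ?B = "tail q0 X"
  have dec: "X l p - ?Z l p = ?B l p" for l p
    using X0[of p l] q0 by (auto simp: Ua_def tail_def not_less)
  have Zle: "norm (?Z l p) \<le> norm (X l p)" for l p by (simp add: Ua_def)
  have Z0: "p \<le> 0 \<Longrightarrow> ?Z k p = 0" for k p by (simp add: Ua_def)
  have finZ: "l1norm (\<lambda>k. ?Z k q) < \<infinity>" using fin by (simp add: l1norm_Ua)
  define d1 d2 d3 where "d1 = fconv (\<lambda>l. v l $ j) (\<lambda>l. X l q) k - fconv (\<lambda>l. v l $ j) (\<lambda>l. ?Z l
      q) k"
    and "d2 = fconv (\<lambda>l. X l q $ j) v k - fconv (\<lambda>l. ?Z l q $ j) v k"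
    and "d3 = flconv (\<lambda>l p. X l p $ j) X k q - flconv (\<lambda>l p. ?Z l p $ j) ?Z k q"
  have "ennreal (norm d1) \<le> (\<integral>\<^sup>+l. ennreal (norm (v l $ j *s X (k - l) q - v l $ j *s ?Z (k - l)
      q)) \<partial>count_space UNIV)"
    unfolding d1_def fconv_eq_integral by (intro norm_integral_diff_le integrable_fconv v fin finZ)
  also have "\<dots> \<le> (\<integral>\<^sup>+l. ennreal (norm (v l)) * ennreal (norm (?B (k - l) q)) \<partial>count_space UNIV)"
  proof (intro nn_integral_mono)
    fix l
    have "v l $ j *s X (k - l) q - v l $ j *s ?Z (k - l) q = v l $ j *s ?B (k - l) q"
      unfolding dec[symmetric] by (simp add: vec_eq_iff algebra_simps)
    then show "ennreal (norm (v l $ j *s X (k - l) q - v l $ j *s ?Z (k - l) q)) \<le>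
        ennreal (norm (v l)) * ennreal (norm (?B (k - l) q))"
      by (simp add: norm_vector_scalar_mult ennreal_mult mult_right_mono
          Finite_Cartesian_Product.norm_nth_le)
  qed
  finally have 1: "ennreal (norm d1) \<le> \<dots>" .
  have "ennreal (norm d2) \<le> (\<integral>\<^sup>+l. ennreal (norm (X l q $ j *s v (k - l) - ?Z l q $ j *s v (k -
      l))) \<partial>count_space UNIV)"
    unfolding d2_def fconv_eq_integral by (intro norm_integral_diff_le integrable_fconv v fin finZ)
  also have "\<dots> \<le> (\<integral>\<^sup>+l. ennreal (norm (?B l q)) * ennreal (norm (v (k - l))) \<partial>count_space UNIV)"
  proof (intro nn_integral_mono)
    fix l
    have "X l q $ j *s v (k - l) - ?Z l q $ j *s v (k - l) = ?B l q $ j *s v (k - l)"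
      unfolding dec[symmetric] by (simp add: vec_eq_iff algebra_simps)
    then show "ennreal (norm (X l q $ j *s v (k - l) - ?Z l q $ j *s v (k - l))) \<le>
        ennreal (norm (?B l q)) * ennreal (norm (v (k - l)))"
      by (simp add: norm_vector_scalar_mult ennreal_mult mult_right_mono
          Finite_Cartesian_Product.norm_nth_le)
  qed
  finally have 2: "ennreal (norm d2) \<le> \<dots>" .
  define c where "c l p = ennreal (norm (X l p)) * ennreal (norm (X (k - l) (q - p)))" for l p
  have [measurable]: "c l \<in> borel_measurable borel" for l unfolding c_def by measurable
  have cfin: "(\<integral>\<^sup>+l. \<integral>\<^sup>+p. c l p \<partial>lborel \<partial>count_space UNIV) < \<infinity>"
    unfolding c_def by (rule order.strict_trans1[OF nn_integral_flconv_le fin2]) measurable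
  have cl: "(\<integral>\<^sup>+p. c l p \<partial>lborel) < \<infinity>" for l
    by (rule order.strict_trans1[OF _ cfin], rule nn_integral_ge_point) simp
  have Xc: "ennreal (norm (X l p $ j *s X (k - l) (q - p))) \<le> c l p" for l p
    by (simp add: c_def norm_vector_scalar_mult ennreal_mult mult_right_mono
        Finite_Cartesian_Product.norm_nth_le)
  have Zc: "ennreal (norm (?Z l p $ j *s ?Z (k - l) (q - p))) \<le> c l p" for l p
    unfolding c_def norm_vector_scalar_mult ennreal_mult[OF norm_ge_zero norm_ge_zero]
    by (intro mult_mono ennreal_leI order_trans[OF Finite_Cartesian_Product.norm_nth_le] Zle) auto
  have iX: "integrable lborel (\<lambda>p. X l p $ j *s X (k - l) (q - p))" for l
    by (rule integrableI_bounded, measurable, rule order.strict_trans1[OF nn_integral_mono[OF Xc]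
        cl])
  have iZ: "integrable lborel (\<lambda>p. ?Z l p $ j *s ?Z (k - l) (q - p))" for l
    by (rule integrableI_bounded, measurable, rule order.strict_trans1[OF nn_integral_mono[OF Zc]
        cl])
  have LX: "lconv (\<lambda>p. X l p $ j) (X (k - l)) q =
      (LINT p|lborel. X l p $ j *s X (k - l) (q - p))" for l
    by (rule lconv_eq_integral) (auto simp: X0)
  have LZ: "lconv (\<lambda>p. ?Z l p $ j) (?Z (k - l)) q =
      (LINT p|lborel. ?Z l p $ j *s ?Z (k - l) (q - p))" for l
    by (rule lconv_eq_integral) (auto simp: Z0)
  have jX: "integrable (count_space UNIV) (\<lambda>l. LINT p|lborel. X l p $ j *s X (k - l) (q - p))"
  proof (rule integrableI_bounded)
    have "(\<integral>\<^sup>+l. ennreal (norm (LINT p|lborel. X l p $ j *s X (k - l) (q - p))) \<partial>count_space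
        UNIV) \<le> (\<integral>\<^sup>+l. \<integral>\<^sup>+p. c l p \<partial>lborel \<partial>count_space UNIV)"
      by (intro nn_integral_mono order_trans[OF integral_norm_bound_ennreal[OF iX]] Xc)
    with cfin show "(\<integral>\<^sup>+l. ennreal (norm (LINT p|lborel. X l p $ j *s X (k - l) (q - p)))
        \<partial>count_space UNIV) < \<infinity>"
      by (rule order.strict_trans1[rotated])
  qed simp
  have jZ: "integrable (count_space UNIV) (\<lambda>l. LINT p|lborel. ?Z l p $ j *s ?Z (k - l) (q - p))"
  proof (rule integrableI_bounded)
    have "(\<integral>\<^sup>+l. ennreal (norm (LINT p|lborel. ?Z l p $ j *s ?Z (k - l) (q - p))) \<partial>count_space
        UNIV) \<le> (\<integral>\<^sup>+l. \<integral>\<^sup>+p. c l p \<partial>lborel \<partial>count_space UNIV)"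
      by (intro nn_integral_mono order_trans[OF integral_norm_bound_ennreal[OF iZ]] Zc)
    with cfin show "(\<integral>\<^sup>+l. ennreal (norm (LINT p|lborel. ?Z l p $ j *s ?Z (k - l) (q - p)))
        \<partial>count_space UNIV) < \<infinity>"
      by (rule order.strict_trans1[rotated])
  qed simp
  have "ennreal (norm d3) \<le> (\<integral>\<^sup>+l. ennreal (norm ((LINT p|lborel. X l p $ j *s X (k - l) (q - p))
      - (LINT p|lborel. ?Z l p $ j *s ?Z (k - l) (q - p)))) \<partial>count_space UNIV)"
    unfolding d3_def flconv_eq_integral LX LZ by (rule norm_integral_diff_le[OF jX jZ])
  also have "\<dots> \<le> (\<integral>\<^sup>+l. \<integral>\<^sup>+p. ennreal (norm (X l p $ j *s X (k - l) (q - p) - ?Z l p $ j *s ?Z (k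
      - l) (q - p))) \<partial>lborel \<partial>count_space UNIV)"
    by (intro nn_integral_mono norm_integral_diff_le iX iZ)
  also have "\<dots> \<le> (\<integral>\<^sup>+l. \<integral>\<^sup>+p. ennreal (norm (?B l p)) * ennreal (norm (X (k - l) (q - p))) +
        ennreal (norm (?Z l p)) * ennreal (norm (?B (k - l) (q - p))) \<partial>lborel \<partial>count_space UNIV)"
  proof (intro nn_integral_mono)
    fix l p
    have "X l p $ j *s X (k - l) (q - p) - ?Z l p $ j *s ?Z (k - l) (q - p) =
       ?B l p $ j *s X (k - l) (q - p) + ?Z l p $ j *s ?B (k - l) (q - p)"
      unfolding dec[symmetric] by (simp add: vec_eq_iff algebra_simps)
    then have "norm (X l p $ j *s X (k - l) (q - p) - ?Z l p $ j *s ?Z (k - l) (q - p)) \<le>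
       norm (?B l p) * norm (X (k - l) (q - p)) + norm (?Z l p) * norm (?B (k - l) (q - p))"
      by (auto simp: norm_vector_scalar_mult intro!: norm_triangle_le add_mono mult_right_mono
          Finite_Cartesian_Product.norm_nth_le)
    then show "ennreal (norm (X l p $ j *s X (k - l) (q - p) - ?Z l p $ j *s ?Z (k - l) (q - p))) \<le>
       ennreal (norm (?B l p)) * ennreal (norm (X (k - l) (q - p))) + ennreal (norm (?Z l p)) *
           ennreal (norm (?B (k - l) (q - p)))"
      by (simp add: ennreal_mult[symmetric] ennreal_plus[symmetric] ennreal_leI del: ennreal_plus)
  qed
  also have "\<dots> = (\<integral>\<^sup>+l. \<integral>\<^sup>+p. ennreal (norm (?B l p)) *
      ennreal (norm (X (k - l) (q - p))) \<partial>lborel \<partial>count_space UNIV) +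
      (\<integral>\<^sup>+l. \<integral>\<^sup>+p. ennreal (norm (?Z l p)) * ennreal (norm (?B (k - l) (q - p))) \<partial>lborel
          \<partial>count_space UNIV)"
    by (simp add: nn_integral_add)
  finally have 3: "ennreal (norm d3) \<le> \<dots>" .
  have "H_hat v X j k q - H_hat v ?Z j k q = leray k (d1 + d2 + d3)"
    unfolding H_hat_def leray_diff[symmetric] d1_def d2_def d3_def by (simp add: algebra_simps)
  then have "norm (H_hat v X j k q - H_hat v ?Z j k q) \<le> norm d1 + norm d2 + norm d3"
    using norm_leray_le[of k "d1 + d2 + d3"] norm_triangle_ineq[of "d1 +
        d2" d3] norm_triangle_ineq[of d1 d2] by simp
  then have "ennreal (norm (H_hat v X j k q - H_hat v ?Z j k q)) \<le> ennreal (norm d1) +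
      ennreal (norm d2) + ennreal (norm d3)"
    by (simp add: ennreal_plus[symmetric] ennreal_leI del: ennreal_plus)
  also have "\<dots> \<le> Hdiff_bound v q0 X k q"
    unfolding Hdiff_bound_def by (intro add_mono 1 2 3)
  finally show ?thesis .
qed

text \<open>A convolution of two functions supported in \<open>(0, q0]\<close> is supported in \<open>(0, 2 q0]\<close>.\<close>

lemma H_hat_Ua_eq_0:
  assumes "q > 2 * q0" "q0 > 0"
  shows "H_hat v (Ua q0 X) j k q = 0"
proof -
  have z: "Ua q0 X l q = 0" for l using assms by (simp add: Ua_def)
  have "lconv (\<lambda>p. Ua q0 X l p $ j) (Ua q0 X m) q = 0" for l m
    unfolding lconv_def set_lebesgue_integral_def
    by (rule integral_eq_zero_AE, rule AE_I2) (use assms in \<open>auto simp: Ua_def vec_eq_iff\<close>)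
  then show ?thesis
    by (simp add: H_hat_def z fconv_def flconv_def)
qed

lemma H_hat_Ua_eq:
  assumes "0 < q" "q \<le> q0"
  shows "H_hat v (Ua q0 X) j k q = H_hat v X j k q"
proof -
  have "lconv (\<lambda>p. Ua q0 X l p $ j) (Ua q0 X m) q = lconv (\<lambda>p. X l p $ j) (X m) q" for l m
    unfolding lconv_def set_lebesgue_integral_def
    by (rule integral_discrete_difference[where X="{0, q}"]) (use assms in \<open>auto simp:
        indicator_def Ua_def\<close>)
  moreover have "Ua q0 X l q = X l q" for l using assms by (simp add: Ua_def)
  ultimately show ?thesis
    by (simp add: H_hat_def flconv_def)
qed

text \<open>For \<open>v = 0\<close> the nonlinear term is a convolution square, so the interval on which it vanishes
  is twice as long as the one on which \<open>X\<close> vanishes.\<close>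

lemma H_hat_eq_0:
  fixes X :: "int^3 \<Rightarrow> real \<Rightarrow> complex^3"
  assumes [measurable]: "\<And>k. X k \<in> borel_measurable borel"
    and X0: "\<And>k p. p \<le> 0 \<Longrightarrow> X k p = 0"
    and ae: "AE p in lborel. p \<le> T \<longrightarrow> (\<forall>k. X k p = 0)" and q: "q \<le> 2 * T"
    and v: "\<And>l. v l = 0"
  shows "H_hat v X j k q = 0"
proof -
  have "lconv (\<lambda>p. X l p $ j) (X m) q = 0" for l m
  proof -
    have 1: "AE p in lborel. p \<le> T \<longrightarrow> X l p = 0" using ae by eventually_elim auto
    have "AE p in lborel. p \<le> T \<longrightarrow> X m p = 0" using ae by eventually_elim auto
    then have 2: "AE p in lborel. q + (-1) * p \<le> T \<longrightarrow> X m (q + (-1) * p) = 0"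
      by (intro AE_borel_affine) auto
    have "AE p in lborel. X l p $ j *s X m (q - p) = 0"
      using 1 2
    proof eventually_elim
      case (elim p)
      have "p \<le> T \<or> q - p \<le> T" using q by linarith
      with elim show ?case by (auto simp: vec_eq_iff)
    qed
    then show ?thesis
      by (subst lconv_eq_integral) (auto simp: X0 intro: integral_eq_zero_AE)
  qed
  then show ?thesis by (simp add: H_hat_def v fconv_def flconv_def)
qed

section \<open>The integral inequality for the tail of the solution\<close>

lemma kernel_le:
  fixes q0 :: real and n :: nat
  defines "\<beta> \<equiv> 1 / 2 - 1 / (2 * real n)"
  assumes "q0 \<le> q'" "q' < q"
  shows "ennreal (norm (wavevec k)) * ennreal (norm (kernel \<nu> n q q' k)) \<le>
    sup_kB0 \<nu> n q0 * ennreal ((q - q') powr (- \<beta>))"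
proof -
  have p: "(q - q') powr (- \<beta>) * (q - q') powr \<beta> = 1"
    using assms by (simp add: powr_minus field_simps)
  have "ennreal ((q - q') powr \<beta> * norm (kernel \<nu> n q q' k)) \<le> B0 \<nu> n q0 k"
    unfolding B0_def \<beta>_def by (rule SUP_upper2[of "(q', q)"]) (use assms in auto)
  then have "ennreal (norm (wavevec k)) * ennreal ((q - q') powr \<beta> * norm (kernel \<nu> n q q' k))
      \<le> ennreal (norm (wavevec k)) * B0 \<nu> n q0 k"
    by (rule mult_left_mono) simp
  also have "\<dots> \<le> sup_kB0 \<nu> n q0"
    unfolding sup_kB0_def by (rule SUP_upper) simp
  finally have "ennreal (norm (wavevec k)) * ennreal ((q - q') powr \<beta> *
      norm (kernel \<nu> n q q' k)) * ennreal ((q - q') powr (- \<beta>))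
      \<le> sup_kB0 \<nu> n q0 * ennreal ((q - q') powr (- \<beta>))"
    by (rule mult_right_mono) simp
  also have "ennreal (norm (wavevec k)) * ennreal ((q - q') powr \<beta> * norm (kernel \<nu> n q q' k)) *
      ennreal ((q - q') powr (- \<beta>))
     = ennreal (norm (wavevec k) * norm (kernel \<nu> n q q' k) * ((q - q') powr (- \<beta>) *
         (q - q') powr \<beta>))"
    by (simp add: ennreal_mult[symmetric] mult_ac)
  also have "\<dots> = ennreal (norm (wavevec k)) * ennreal (norm (kernel \<nu> n q q' k))"
    by (simp add: p ennreal_mult)
  finally show ?thesis .
qed

text \<open>The two right-hand sides differ only through the nonlinear terms at \<open>q0 < q' < q\<close>: these
  agree for \<open>q' \<le> q0\<close>, and that of \<open>Ua\<close> vanishes beyond \<open>2 q0\<close>, which removes the upper limit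
  \<open>min q (2 * q0)\<close>. The finiteness of the majorant \<open>C\<close> yields the existence of the integrals
  in \<open>Us\<close> from that of the integrals in the equation for \<open>U\<close>.\<close>

lemma duhamel_diff_le:
  fixes U :: "int^3 \<Rightarrow> real \<Rightarrow> complex^3"
  defines "W \<equiv> \<lambda>k q. if 0 < q then U k q else 0"
  assumes W: "\<And>k. W k \<in> borel_measurable borel" and q0: "q0 > 0" and q: "q > q0"
    and int: "\<And>j. set_integrable lborel {0..q} (\<lambda>q'. kernel \<nu> n q q' k *s H_hat v U j k q')"
    and ae: "\<And>j. AE q' in lborel. ennreal (norm (H_hat v W j k q' - H_hat v (Ua q0 W) j k q')) \<le>
        E q'"
    and C: "C = (\<integral>\<^sup>+q'. (if q0 < q' \<and> q' < q then ennreal (norm (kernel \<nu> n q q' k)) else 0) *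
        E q' \<partial>lborel)"
    and Cfin: "C < \<infinity>"
  shows "ennreal (norm (duhamel \<nu> n v fh U q k q - Us \<nu> n v fh q0 U k q)) \<le> 2 *
      ennreal (norm (wavevec k)) * C"
proof -
  define f g where "f j q' = indicator {0..q} q' *\<^sub>R (kernel \<nu> n q q' k *s H_hat v U j k q')"
    and "g j q' = indicator {0..min q (2 * q0)} q' *\<^sub>R (kernel \<nu> n q q' k *s H_hat v (Ua q0 U) j
        k q')" for j q'
  have UaW: "Ua q0 U = Ua q0 W" by (simp add: Ua_def W_def fun_eq_iff)
  have f: "integrable lborel (f j)" for j
    using int[of j] by (simp add: set_integrable_def f_def[abs_def])
  have [measurable]: "H_hat v (Ua q0 W) j k \<in> borel_measurable borel" for j
    by (rule borel_measurable_H_hat) (auto simp: Ua_def intro!: borel_measurable_Ua W)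
  have g: "g j \<in> borel_measurable borel" for j
    unfolding g_def[abs_def] UaW by measurable
  have fg: "AE q' in lborel. ennreal (norm (f j q' - g j q')) \<le>
      (if q0 < q' \<and> q' < q then ennreal (norm (kernel \<nu> n q q' k)) else 0) * E q'" for j
    using ae[of j] AE_lborel_singleton[of 0] AE_lborel_singleton[of q]
  proof eventually_elim
    case (elim q')
    consider "q' < 0 \<or> q' > q" | "0 < q'" "q' \<le> q0" | "q0 < q'" "q' < q" using elim by linarith
    then show ?case
    proof cases
      case 1
      then have "f j q' = 0" "g j q' = 0" by (auto simp: f_def g_def)
      then show ?thesis by simp
    next
      case 2
      then have "f j q' = g j q'" using q by (simp add: f_def g_def H_hat_Ua_eq)
      then show ?thesis by simp
    next
      case 3
      then have "q' > 0" using q0 by simp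
      then have "H_hat v U j k q' = H_hat v W j k q'" by (rule H_hat_cong) (simp add: W_def)
      moreover have "g j q' = kernel \<nu> n q q' k *s H_hat v (Ua q0 W) j k q'"
        using 3 q0 H_hat_Ua_eq_0[of q0 q' v W j k] by (auto simp: g_def UaW indicator_def)
      ultimately have eq: "f j q' - g j q' = kernel \<nu> n q q' k *s (H_hat v W j k q' - H_hat v (Ua
          q0 W) j k q')"
        using 3 q0 by (simp add: f_def vector_ssub_ldistrib)
      show ?thesis using 3 elim
        unfolding eq norm_vector_scalar_mult by (simp add: ennreal_mult mult_left_mono)
    qed
  qed
  have fgC: "(\<integral>\<^sup>+q'. ennreal (norm (f j q' - g j q')) \<partial>lborel) \<le> C" for j
    unfolding C by (rule nn_integral_mono_AE[OF fg])
  have gi: "integrable lborel (g j)" for j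
  proof -
    have "integrable lborel (\<lambda>q'. f j q' - g j q')"
      using f[of j] g[of j] order.strict_trans1[OF fgC[of j] Cfin]
          by (intro integrableI_bounded) auto
    from Bochner_Integration.integrable_diff[OF f[of j] this] show ?thesis by simp
  qed
  define c where "c = enn2real C"
  have c: "C = ennreal c" "c \<ge> 0" using Cfin by (auto simp: c_def)
  have d: "norm ((LINT q'|lborel. f j q') - (LINT q'|lborel. g j q')) \<le> c" for j
    using order_trans[OF norm_integral_diff_le[OF f gi] fgC, of j] c by simp
  have "duhamel \<nu> n v fh U q k q - Us \<nu> n v fh q0 U k q =
     - (\<Sum>j\<in>UNIV. (\<i> * of_int (k $ j)) *s ((LINT q'|lborel. f j q') - (LINT q'|lborel. g j q')))"
    unfolding duhamel_def Us_def f_def g_def set_lebesgue_integral_def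
    by (simp add: vector_ssub_ldistrib sum_subtractf)
  then have "norm (duhamel \<nu> n v fh U q k q - Us \<nu> n v fh q0 U k q) \<le>
     (\<Sum>j\<in>UNIV. norm ((\<i> * of_int (k $ j)) *s ((LINT q'|lborel. f j q') - (LINT q'|lborel. g j
         q'))))"
    by (simp only: norm_minus_cancel norm_sum)
  also have "\<dots> \<le> (\<Sum>j\<in>UNIV. \<bar>of_int (k $ j)\<bar> * c)"
    unfolding norm_vector_scalar_mult by (intro sum_mono) (simp add: norm_mult mult_left_mono d)
  also have "\<dots> \<le> 2 * norm (wavevec k) * c"
    unfolding sum_distrib_right[symmetric] by (intro mult_right_mono sum_abs_component_le c)
  finally have "ennreal (norm (duhamel \<nu> n v fh U q k q - Us \<nu> n v fh q0 U k q)) \<le> ennreal (2 *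
      norm (wavevec k) * c)"
    by (rule ennreal_leI)
  also have "\<dots> = 2 * ennreal (norm (wavevec k)) * C"
    using c by (simp add: ennreal_mult)
  finally show ?thesis .
qed

lemma IE_solution_borel_measurable:
  assumes "IE_solution \<nu> n v fh U"
  shows "(\<lambda>q. if 0 < q then U k q else 0) \<in> borel_measurable borel"
proof -
  have "(\<lambda>q. indicator {0<..} q *\<^sub>R U k q) \<in> borel_measurable borel"
    using assms by (simp add: IE_solution_def set_borel_measurable_def)
  also have "(\<lambda>q. indicator {0<..} q *\<^sub>R U k q) = (\<lambda>q. if 0 < q then U k q else 0)"
    by (auto simp: indicator_def fun_eq_iff)
  finally show ?thesis .
qed

lemma nn_integral_weighted_l1norm:
  "(\<integral>\<^sup>+q\<in>{0<..}. (ennreal (exp (- \<alpha> * q)) * l1norm (\<lambda>k. U k q)) \<partial>lborel)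
      = (\<integral>\<^sup>+q. ennreal (exp (- \<alpha> * q)) * l1norm (\<lambda>k. if 0 < q then U k q else 0) \<partial>lborel)"
  by (intro nn_integral_cong) (auto simp: indicator_def l1norm_def)

lemma IE_solution_exp_moment:
  assumes "IE_solution \<nu> n v fh U"
  shows "\<exists>\<alpha>. (\<integral>\<^sup>+q. ennreal (exp (- \<alpha> * q)) * l1norm (\<lambda>k. if 0 < q then U k q else 0) \<partial>lborel) < \<infinity>"
  using assms eventually_happens[of _ "at_top :: real filter"]
  unfolding IE_solution_def nn_integral_weighted_l1norm by auto

text \<open>Taking norms in the integral equation and summing over the wave vectors. Where the last term on
  the right is infinite there is nothing to prove; elsewhere it supplies the finiteness needed
  in \<open>duhamel_diff_le\<close>.\<close>

lemma tail_inequality: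
  fixes U :: "int^3 \<Rightarrow> real \<Rightarrow> complex^3" and q0 :: real and n :: nat
  defines "u \<equiv> \<lambda>q. l1norm (\<lambda>k. if 0 < q then U k q else 0)"
    and "\<beta> \<equiv> 1 / 2 - 1 / (2 * real n)"
  defines "ua \<equiv> \<lambda>q. if q \<le> q0 then u q else 0" and "ub \<equiv> \<lambda>q. if q0 < q then u q else 0"
  assumes IE: "IE_solution \<nu> n v fh U" and v: "l1norm v < \<infinity>" and q0: "q0 > 0"
  shows "AE q in lborel. q0 < q \<longrightarrow> u q \<le> l1norm (\<lambda>k. Us \<nu> n v fh q0 U k q) +
     2 * sup_kB0 \<nu> n q0 * (\<integral>\<^sup>+q'. (if q0 < q' \<and> q' < q then ennreal ((q - q') powr (- \<beta>)) else 0) *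
        (2 * l1norm v * ub q' + nconv ub u q' + nconv ua ub q') \<partial>lborel)"
proof -
  define W where "W k q = (if 0 < q then U k q else 0)" for k q
  have u: "u q = l1norm (\<lambda>k. W k q)" for q by (simp add: u_def W_def)
  have W0: "p \<le> 0 \<Longrightarrow> W k p = 0" for k p by (simp add: W_def)
  have Wm [measurable]: "W k \<in> borel_measurable borel" for k
    using IE_solution_borel_measurable[OF IE] by (simp add: W_def[abs_def])
  have um [measurable]: "u \<in> borel_measurable borel"
    unfolding u[abs_def] by (rule borel_measurable_l1norm) measurable
  obtain \<alpha>' where \<alpha>': "(\<integral>\<^sup>+q. ennreal (exp (- \<alpha>' * q)) * u q \<partial>lborel) < \<infinity>"
    using IE_solution_exp_moment[OF IE] unfolding u_def by blast
  have ufin: "AE q in lborel. u q < \<infinity>"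
  proof -
    have "AE q in lborel. ennreal (exp (- \<alpha>' * q)) * u q \<noteq> \<infinity>"
      using \<alpha>' by (intro nn_integral_PInf_AE) auto
    then show ?thesis by eventually_elim (auto simp: ennreal_mult_eq_top_iff less_top)
  qed
  have uufin: "AE q in lborel. nconv u u q < \<infinity>"
  proof -
    have "(\<integral>\<^sup>+q. ennreal (exp (- \<alpha>' * q)) * nconv u u q \<partial>lborel) = (\<integral>\<^sup>+q. ennreal (exp (- \<alpha>' *
        q)) * u q \<partial>lborel) * (\<integral>\<^sup>+q. ennreal (exp (- \<alpha>' * q)) * u q \<partial>lborel)"
      by (subst exp_weight_nconv, measurable, rule nn_integral_nconv) measurable
    also have "\<dots> < \<infinity>" using \<alpha>' by (simp add: ennreal_mult_less_top)
    finally have "AE q in lborel. ennreal (exp (- \<alpha>' * q)) * nconv u u q \<noteq> \<infinity>"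
      by (intro nn_integral_PInf_AE) auto
    then show ?thesis by eventually_elim (auto simp: ennreal_mult_eq_top_iff less_top)
  qed
  define E where "E k q = Hdiff_bound v q0 W k q" for k q
  have [measurable]: "E k \<in> borel_measurable borel" for k unfolding E_def by measurable
  have ae: "AE q in lborel. \<forall>k j. ennreal (norm (H_hat v W j k q - H_hat v (Ua q0 W) j k q)) \<le>
      E k q"
    using ufin uufin
  proof eventually_elim
    case (elim q)
    then show ?case
      unfolding E_def u by (intro allI norm_H_hat_diff_le Wm W0 q0 v)
  qed
  define h where "h q = 2 * l1norm v * ub q + nconv ub u q + nconv ua ub q" for q
  have Eh: "(\<integral>\<^sup>+k. E k q \<partial>count_space UNIV) = h q" for q
  proof -
    have "ua = (\<lambda>q. l1norm (\<lambda>k. Ua q0 W k q))"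
      by (auto simp: ua_def l1norm_Ua u fun_eq_iff not_less W0) (simp add: l1norm_def)
    moreover have "ub = (\<lambda>q. l1norm (\<lambda>k. tail q0 W k q))"
      by (simp add: ub_def l1norm_tail u fun_eq_iff)
    ultimately show ?thesis 
      unfolding E_def h_def sum_Hdiff_bound[OF Wm] by (simp add: u[abs_def])
  qed
  define S where "S = sup_kB0 \<nu> n q0"
  define \<kappa> where "\<kappa> q q' = (if q0 < q' \<and> q' < q then ennreal ((q - q') powr (- \<beta>)) else 0)" for q q'
  have [measurable]: "\<kappa> q \<in> borel_measurable borel" for q unfolding \<kappa>_def by measurable
  define I where "I q = S * (\<integral>\<^sup>+q'. \<kappa> q q' * h q' \<partial>lborel)" for q
  have Isum: "(\<integral>\<^sup>+k. S * (\<integral>\<^sup>+q'. \<kappa> q q' * E k q' \<partial>lborel) \<partial>count_space UNIV) = I q" for q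
  proof -
    have "(\<integral>\<^sup>+k. S * (\<integral>\<^sup>+q'. \<kappa> q q' * E k q' \<partial>lborel) \<partial>count_space UNIV) = S *
        (\<integral>\<^sup>+k. \<integral>\<^sup>+q'. \<kappa> q q' * E k q' \<partial>lborel \<partial>count_space UNIV)"
      by (simp add: nn_integral_cmult)
    also have "(\<integral>\<^sup>+k. \<integral>\<^sup>+q'. \<kappa> q q' * E k q' \<partial>lborel \<partial>count_space UNIV) = (\<integral>\<^sup>+q'. \<integral>\<^sup>+k. \<kappa> q q' *
        E k q' \<partial>count_space UNIV \<partial>lborel)"
      by (rule nn_integral_count_space_nn_integral[symmetric]) auto
    also have "\<dots> = (\<integral>\<^sup>+q'. \<kappa> q q' * h q' \<partial>lborel)"
      by (simp add: nn_integral_cmult Eh)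
    finally show ?thesis by (simp add: I_def)
  qed
  have "AE q in lborel. q0 < q \<longrightarrow> u q \<le> l1norm (\<lambda>k. Us \<nu> n v fh q0 U k q) + 2 * I q"
  proof -
    have "AE q in lborel. 0 < q \<longrightarrow>
        (\<forall>k. (\<forall>j. set_integrable lborel {0..q} (\<lambda>q'. kernel \<nu> n q q' k *s H_hat v U j k q')) \<and>
             U k q = duhamel \<nu> n v fh U q k q)"
      using IE by (simp add: IE_solution_def)
    then show ?thesis
    proof eventually_elim
      case (elim q)
      show ?case
      proof (cases "q0 < q \<and> I q < \<infinity>")
        case True
        then have q: "q0 < q" "0 < q" using q0 by auto
        have k: "ennreal (norm (U k q)) \<le> ennreal (norm (Us \<nu> n v fh q0 U k q)) + 2 * (S *
            (\<integral>\<^sup>+q'. \<kappa> q q' * E k q' \<partial>lborel))" for k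
        proof -
          define C where "C = (\<integral>\<^sup>+q'. (if q0 < q' \<and> q' < q then ennreal (norm (kernel \<nu> n q q'
              k)) else 0) * E k q' \<partial>lborel)"
          have kC: "ennreal (norm (wavevec k)) * C \<le> S * (\<integral>\<^sup>+q'. \<kappa> q q' * E k q' \<partial>lborel)"
          proof -
            have "ennreal (norm (wavevec k)) * C = (\<integral>\<^sup>+q'. ennreal (norm (wavevec k)) *
                ((if q0 < q' \<and> q' < q then ennreal (norm (kernel \<nu> n q q' k)) else 0) *
                E k q') \<partial>lborel)"
              unfolding C_def by (rule nn_integral_cmult[symmetric]) measurable
            also have "\<dots> \<le> (\<integral>\<^sup>+q'. S * (\<kappa> q q' * E k q') \<partial>lborel)"
              using kernel_le[of q0 _ q k \<nu> n]
              by (intro nn_integral_mono) (auto simp: \<kappa>_def S_def \<beta>_def mult.assoc[symmetric]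
                  intro!: mult_right_mono)
            also have "\<dots> = S * (\<integral>\<^sup>+q'. \<kappa> q q' * E k q' \<partial>lborel)"
                by (rule nn_integral_cmult) measurable
            finally show ?thesis .
          qed
          have "S * (\<integral>\<^sup>+q'. \<kappa> q q' * E k q' \<partial>lborel) \<le> I q"
            unfolding Isum[symmetric] by (rule nn_integral_ge_point) simp
          then have kCfin: "ennreal (norm (wavevec k)) * C < \<infinity>"
            using True kC by (auto intro: order.strict_trans1)
          have Cfin: "C < \<infinity>"
          \<comment> \<open>nonzero wave vectors have length at least \<open>1\<close>\<close>
          proof (cases "k = 0")
            case True
            then have "C = (\<integral>\<^sup>+q'. 0 \<partial>(lborel :: real measure))"
              unfolding C_def by (intro nn_integral_cong) (simp add: kernel_def)
            then show ?thesis by simp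
          next
            case False
            have "1 * C \<le> ennreal (norm (wavevec k)) * C"
              using norm_wavevec_ge_1[OF False] by (intro mult_right_mono) auto
            with kCfin show ?thesis by (auto intro: order.strict_trans1)
          qed
          have "ennreal (norm (duhamel \<nu> n v fh U q k q - Us \<nu> n v fh q0 U k q)) \<le> 2 *
              ennreal (norm (wavevec k)) * C"
          proof (rule duhamel_diff_le[OF _ q0 q(1) _ _ C_def Cfin])
            show "(\<lambda>q. if 0 < q then U k q else 0) \<in> borel_measurable borel" for k
              using Wm[of k] by (simp add: W_def[abs_def])
            show "set_integrable lborel {0..q} (\<lambda>q'. kernel \<nu> n q q' k *s H_hat v U j k q')" for j
              using elim q by blast
            show "AE q' in lborel. ennreal (norm (H_hat v (\<lambda>k q.
                if 0 < q then U k q else 0) j k q' - H_hat v (Ua q0 (\<lambda>k q.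
                if 0 < q then U k q else 0)) j k q')) \<le> E k q'" for j
              using ae unfolding W_def[abs_def] by eventually_elim blast
          qed
          also have "\<dots> \<le> 2 * (S * (\<integral>\<^sup>+q'. \<kappa> q q' * E k q' \<partial>lborel))"
            unfolding mult.assoc by (intro mult_left_mono kC) simp
          finally have *: "ennreal (norm (U k q - Us \<nu> n v fh q0 U k q)) \<le> \<dots>"
            using elim q by simp
          have "ennreal (norm (U k q)) \<le> ennreal (norm (Us \<nu> n v fh q0 U k q) +
              norm (U k q - Us \<nu> n v fh q0 U k q))"
            by (intro ennreal_leI) norm
          also have "\<dots> \<le> ennreal (norm (Us \<nu> n v fh q0 U k q)) + 2 * (S * (\<integral>\<^sup>+q'. \<kappa> q q' *
              E k q' \<partial>lborel))"
            using * by (simp add: add_left_mono)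
          finally show ?thesis .
        qed
        have "u q = (\<integral>\<^sup>+k. ennreal (norm (U k q)) \<partial>count_space UNIV)"
          using q by (simp add: u_def l1norm_def)
        also have "\<dots> \<le> (\<integral>\<^sup>+k. ennreal (norm (Us \<nu> n v fh q0 U k q)) + 2 * (S * (\<integral>\<^sup>+q'. \<kappa> q q' *
            E k q' \<partial>lborel)) \<partial>count_space UNIV)"
          by (intro nn_integral_mono k)
        also have "\<dots> = l1norm (\<lambda>k. Us \<nu> n v fh q0 U k q) + 2 * I q"
          unfolding Isum[symmetric] l1norm_def by (simp add: nn_integral_add nn_integral_cmult)
        finally show ?thesis by simp
      next
        case False
        then show ?thesis by (auto simp: not_less top_unique ennreal_mult_top)
      qed
    qed
  qed
  then show ?thesis by (simp add: I_def S_def \<kappa>_def h_def mult.assoc)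
qed

section \<open>Vanishing data\<close>

text \<open>With \<open>v = 0\<close> and \<open>U = 0\<close> on \<open>(0, T]\<close>, the nonlinear term vanishes on \<open>(0, 2 T]\<close>, so
  \<open>U\<close> equals \<open>U0_hat\<close> almost everywhere there. In turn \<open>U0_hat\<close> equals \<open>Us\<close>, whose weighted integral
  beyond \<open>q0\<close> is \<open>0\<close>. Hence \<open>U\<close> vanishes almost everywhere on an interval of twice the length, and,
  by iteration, on the half-line. No bound on the kernel is used.\<close>

lemma vanishing_propagates:
  fixes U :: "int^3 \<Rightarrow> real \<Rightarrow> complex^3"
  assumes IE: "IE_solution \<nu> n v fh U" and v: "\<And>l. v l = 0" and q0: "q0 > 0"
    and init: "AE q in lborel. 0 < q \<and> q \<le> q0 \<longrightarrow> (\<forall>k. U k q = 0)"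
    and Us: "(\<integral>\<^sup>+q\<in>{q0<..}. (ennreal (exp (- \<alpha> * q)) *
        l1norm (\<lambda>k. Us \<nu> n v fh q0 U k q)) \<partial>lborel) = 0"
  shows "AE q in lborel. 0 < q \<longrightarrow> (\<forall>k. U k q = 0)"
proof -
  define W where "W k q = (if 0 < q then U k q else 0)" for k q
  have W0: "p \<le> 0 \<Longrightarrow> W k p = 0" for k p by (simp add: W_def)
  have Wm [measurable]: "W k \<in> borel_measurable borel" for k
    using IE_solution_borel_measurable[OF IE] by (simp add: W_def[abs_def])
  have UaW: "Ua q0 U = Ua q0 W" by (simp add: Ua_def W_def fun_eq_iff)
  have Ua0: "AE p in lborel. \<forall>k. Ua q0 W k p = 0"
    using init by eventually_elim (auto simp: Ua_def W_def)
  have HUa: "H_hat v (Ua q0 W) j k q = 0" for j k q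
  proof (rule H_hat_eq_0[where T="\<bar>q\<bar>" and X="Ua q0 W"])
    show "AE p in lborel. p \<le> \<bar>q\<bar> \<longrightarrow> (\<forall>k. Ua q0 W k p = 0)"
      using Ua0 by eventually_elim simp
  qed (use v in \<open>auto simp: Ua_def intro!: borel_measurable_Ua Wm\<close>)
  have Us_eq: "Us \<nu> n v fh q0 U k q = U0_hat \<nu> n v fh k q" for k q
    by (simp add: Us_def duhamel_def UaW HUa)
  have *: "AE p in lborel. p \<le> 2 ^ m * q0 \<longrightarrow> (\<forall>k. W k p = 0)" for m
  proof (induction m)
    case 0
    show ?case using init by eventually_elim (auto simp: W_def)
  next
    case (Suc m)
    define T where "T = 2 ^ m * q0"
    have H: "H_hat v U j k q' = 0" if "0 < q'" "q' \<le> 2 * T" for j k q'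
    proof -
      have "H_hat v U j k q' = H_hat v W j k q'"
        by (rule H_hat_cong[OF that(1)]) (simp add: W_def)
      also have "\<dots> = 0"
        by (rule H_hat_eq_0[OF Wm W0 Suc that(2)[unfolded T_def] v])
      finally show ?thesis .
    qed
    have eq: "AE q in lborel. 0 < q \<and> q \<le> 2 * T \<longrightarrow> (\<forall>k. W k q = Us \<nu> n v fh q0 U k q)"
    proof -
      have "AE q in lborel. 0 < q \<longrightarrow> (\<forall>k. U k q = duhamel \<nu> n v fh U q k q)"
        using IE by (auto simp: IE_solution_def elim: eventually_mono)
      then show ?thesis
      proof eventually_elim
        case (elim q)
        show ?case
        proof (intro impI allI)
          fix k assume q: "0 < q \<and> q \<le> 2 * T"
          have "(LINT q':{0..q}|lborel. kernel \<nu> n q q' k *s H_hat v U j k q') = 0" for j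
            unfolding set_lebesgue_integral_def
          proof (rule integral_eq_zero_AE)
            show "AE q' in lborel. indicator {0..q} q' *\<^sub>R (kernel \<nu> n q q' k *s H_hat v U j k
                q') = 0"
              using AE_lborel_singleton[of 0] by eventually_elim (use q H in \<open>auto simp:
                  indicator_def\<close>)
          qed
          then show "W k q = Us \<nu> n v fh q0 U k q"
            using elim q by (simp add: W_def Us_eq duhamel_def)
        qed
      qed
    qed
    let ?g = "\<lambda>q. ennreal (exp (- \<alpha> * q)) * l1norm (\<lambda>k. W k q) * indicator {q0<..2 * T} q"
    have [measurable]: "(\<lambda>q. l1norm (\<lambda>k. W k q)) \<in> borel_measurable borel"
      by (rule borel_measurable_l1norm) measurable
    have "(\<integral>\<^sup>+q. ?g q \<partial>lborel) \<le> 0"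
      unfolding Us[symmetric]
      by (rule nn_integral_mono_AE, use eq in eventually_elim) (use q0 in \<open>auto simp:
          indicator_def\<close>)
    then have "AE q in lborel. ?g q = 0"
      by (subst (asm) le_zero_eq, subst (asm) nn_integral_0_iff_AE) auto
    then show ?case using init
    proof eventually_elim
      case (elim q)
      show ?case
      proof (intro impI allI)
        fix k assume q: "q \<le> 2 ^ Suc m * q0"
        consider "q \<le> 0" | "0 < q" "q \<le> q0" | "q0 < q" by linarith
        then show "W k q = 0"
        proof cases
          case 3
          with q elim(1) have "l1norm (\<lambda>k. W k q) = 0" by (simp add: T_def)
          then show ?thesis by (simp add: l1norm_eq_0_iff)
        qed (use elim(2) in \<open>auto simp: W_def\<close>)
      qed
    qed
  qed
  have "AE p in lborel. \<forall>m. p \<le> 2 ^ m * q0 \<longrightarrow> (\<forall>k. W k p = 0)"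
    unfolding AE_all_countable using * by blast
  then show ?thesis
  proof eventually_elim
    case (elim q)
    obtain m where "q / q0 < 2 ^ m" using real_arch_pow[of 2 "q / q0"] by auto
    then have "q \<le> 2 ^ m * q0" using q0 by (simp add: field_simps)
    with elim show ?case by (auto simp: W_def)
  qed
qed

section \<open>Exponential integrability of the solution\<close>

theorem theorem3p1:
  fixes \<nu> q0 \<alpha> :: real and n :: nat
    and v0 f :: "real^3 \<Rightarrow> real^3"
    and U :: "int^3 \<Rightarrow> real \<Rightarrow> complex^3"
  assumes "n \<ge> 1" and "\<nu> > 0"
    and "admissible_field v0" and "admissible_field f"
    and "IE_solution \<nu> n (fourier v0) (fourier f) U"
    and "q0 > 0" and "\<alpha> > 0"
    and "b_fun \<nu> n (fourier v0) (fourier f) q0 \<alpha> U < \<infinity>"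
    and "ennreal (\<alpha> powr (1 / 2 + 1 / (2 * real n))) >
           eps1 \<nu> n (fourier v0) q0 \<alpha> U +
           2 * enn_sqrt (eps \<nu> n q0 * b_fun \<nu> n (fourier v0) (fourier f) q0 \<alpha> U)"
  shows "(\<integral>\<^sup>+q\<in>{0<..}. (l1norm (\<lambda>k. U k q) * ennreal (exp (- \<alpha> * q))) \<partial>lborel) < \<infinity>"
proof -
  define v where "v = fourier v0"
  define fh where "fh = fourier f"
  define u where "u q = l1norm (\<lambda>k. if 0 < q then U k q else 0)" for q
  define us where "us q = l1norm (\<lambda>k. Us \<nu> n v fh q0 U k q)" for q
  define w where "w q = ennreal (exp (- \<alpha> * q))" for q
  define \<beta> where "\<beta> = 1 / 2 - 1 / (2 * real n)"
  define S where "S = sup_kB0 \<nu> n q0"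
  define V where "V = l1norm v"
  define A where "A = \<alpha> powr (1 - \<beta>)"
  define \<Gamma> where "\<Gamma> = Gamma (1 - \<beta>)"
  define b0 where "b0 = (\<integral>\<^sup>+q\<in>{q0<..}. (w q * us q) \<partial>lborel)"
  note q0 = \<open>q0 > 0\<close> and \<alpha> = \<open>\<alpha> > 0\<close>
  have IE: "IE_solution \<nu> n v fh U" using assms by (simp add: v_def fh_def)
  have V: "V < \<infinity>" using assms by (simp add: V_def v_def admissible_field_def)
  have \<beta>: "\<beta> < 1" "1 / 2 + 1 / (2 * real n) = 1 - \<beta>"
    using \<open>n \<ge> 1\<close> by (auto simp: \<beta>_def field_simps)
  have A: "A > 0" using \<alpha> by (simp add: A_def)
  have \<Gamma>: "\<Gamma> > 0" using \<beta> by (simp add: \<Gamma>_def Gamma_real_pos)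
  have um [measurable]: "u \<in> borel_measurable borel"
    using borel_measurable_l1norm[OF IE_solution_borel_measurable[OF IE]]
        by (simp add: u_def[abs_def])
  have [measurable]: "w \<in> borel_measurable borel" unfolding w_def by measurable
  have u0: "u q = 0" if "q \<le> 0" for q using that by (simp add: u_def l1norm_def)
  obtain \<alpha>' where \<alpha>': "(\<integral>\<^sup>+q. ennreal (exp (- \<alpha>' * q)) * u q \<partial>lborel) < \<infinity>"
    using IE_solution_exp_moment[OF IE] unfolding u_def by blast
  have goal: "(\<integral>\<^sup>+q\<in>{0<..}. (l1norm (\<lambda>k. U k q) * ennreal (exp (- \<alpha> * q))) \<partial>lborel) =
      (\<integral>\<^sup>+q. w q * u q \<partial>lborel)"
    using nn_integral_weighted_l1norm[of \<alpha> U] by (simp add: w_def u_def mult.commute)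
  have b: "b_fun \<nu> n v fh q0 \<alpha> U = ennreal A * b0"
    by (simp add: b_fun_def \<beta> A_def b0_def us_def w_def)
  have b0fin: "b0 < \<infinity>"
    using assms(8) A b by (auto simp: v_def fh_def ennreal_mult_less_top)
  have e: "eps \<nu> n q0 = ennreal \<Gamma> * (2 * S)"
    by (simp add: eps_def B3_def S_def \<Gamma>_def \<beta>)
  have lUa: "l1norm (\<lambda>k. Ua q0 U k q) * indicator {0<..q0} q = u q * indicator {0<..q0} q" for q
    by (auto simp: l1norm_Ua u_def indicator_def)
  have B2: "ennreal (exp (- \<alpha> * q)) * B2 \<nu> n q0 U q * indicator {0<..q0} q = 4 * S * (w q * u q *
      indicator {0<..q0} q)" for q
  proof -
    have "ennreal (exp (- \<alpha> * q)) * B2 \<nu> n q0 U q * indicator {0<..q0} q = 4 * S * (w q *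
        (l1norm (\<lambda>k. Ua q0 U k q) * indicator {0<..q0} q))"
      by (simp add: B2_def S_def w_def mult_ac)
    then show ?thesis unfolding lUa by (simp add: mult_ac)
  qed
  have e1: "eps1 \<nu> n v q0 \<alpha> U = ennreal \<Gamma> * (4 * S * V + 4 * S * (\<integral>\<^sup>+q\<in>{0<..q0}. (w q *
      u q) \<partial>lborel))"
    unfolding eps1_def B2 by (simp add: B1_def S_def V_def \<Gamma>_def \<beta> nn_integral_cmult)
  have gap: "ennreal A > ennreal \<Gamma> * (4 * S * V + 4 * S * (\<integral>\<^sup>+q\<in>{0<..q0}. (w q * u q) \<partial>lborel)) +
       2 * enn_sqrt (ennreal \<Gamma> * (2 * S) * (ennreal A * b0))"
    using assms(9) unfolding \<beta>(2) A_def[symmetric] e1[symmetric] e[symmetric] b[symmetric]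
        by (simp add: v_def fh_def)
  show ?thesis
  proof (cases "S < \<infinity>")
    case True
    show ?thesis unfolding goal w_def
    proof (rule laplace_bootstrap[where ?q0.0=q0 and us=us and \<beta>=\<beta> and S=S and V=V])
      show "AE q in lborel. q0 < q \<longrightarrow> u q \<le> us q +
        2 * S * (\<integral>\<^sup>+q'. (if q0 < q' \<and> q' < q then ennreal ((q - q') powr (- \<beta>)) else 0) * 
        (2 * V * (if q0 < q' then u q' else 0) + nconv (\<lambda>q. if q0 < q then u q else 0) u q' +
            nconv (\<lambda>q. if q \<le> q0 then u q else 0) (\<lambda>q. if q0 < q then u q else 0) q') \<partial>lborel)"
        using tail_inequality[OF IE V[unfolded V_def] q0] unfolding u_def us_def \<beta>_def S_def V_def .
    qed (use um u0 q0 \<alpha> \<beta>(1) \<alpha>' b0fin gap True in \<open>simp_all add: w_def b0_def A_def \<Gamma>_def\<close>)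
  next
    case False
    \<comment> \<open>as \<open>0 * \<infinity> = 0\<close>, the hypothesis can hold here, but only for vanishing data\<close>
    then have S: "S = \<infinity>" by (simp add: less_top[symmetric])
    have lt: "x < \<infinity>" if "x \<le> y" "y < ennreal A" for x y :: ennreal
      using that by (metis ennreal_less_top infinity_ennreal_def order.strict_trans
          order.strict_trans1)
    have "ennreal \<Gamma> * (4 * S * V + 4 * S * (\<integral>\<^sup>+q\<in>{0<..q0}. (w q * u q) \<partial>lborel)) < \<infinity>"
      by (rule lt[OF _ gap]) simp
    then have "4 * S * V + 4 * S * (\<integral>\<^sup>+q\<in>{0<..q0}. (w q * u q) \<partial>lborel) < \<infinity>"
      using \<Gamma> by (auto simp: ennreal_mult_less_top)
    then have V0: "V = 0" and I0: "(\<integral>\<^sup>+q\<in>{0<..q0}. (w q * u q) \<partial>lborel) = 0"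
      by (auto simp: S ennreal_mult_less_top ennreal_mult_top)
    have "enn_sqrt (ennreal \<Gamma> * (2 * S) * (ennreal A * b0)) < \<infinity>"
    proof (rule lt[OF _ gap])
      have "enn_sqrt (ennreal \<Gamma> * (2 * S) * (ennreal A * b0)) \<le> 2 * enn_sqrt (ennreal \<Gamma> * (2 *
          S) * (ennreal A * b0))"
        by (simp add: mult_2)
      also have "\<dots> \<le> ennreal \<Gamma> * (4 * S * V + 4 * S * (\<integral>\<^sup>+q\<in>{0<..q0}. (w q * u q) \<partial>lborel)) + \<dots>"
          by simp
      finally show "enn_sqrt (ennreal \<Gamma> * (2 * S) * (ennreal A * b0)) \<le> \<dots>" .
    qed
    then have "ennreal \<Gamma> * (2 * S) * (ennreal A * b0) < \<infinity>"
      by (auto simp: enn_sqrt_def less_top split: if_splits)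
    then have b00: "b0 = 0" using \<Gamma> A by (auto simp: S ennreal_mult_less_top)
    have v: "v l = 0" for l using V0 by (simp add: V_def l1norm_eq_0_iff)
    have init: "AE q in lborel. 0 < q \<and> q \<le> q0 \<longrightarrow> (\<forall>k. U k q = 0)"
    proof -
      have "AE q in lborel. w q * u q * indicator {0<..q0} q = 0"
        using I0 by (subst (asm) nn_integral_0_iff_AE) auto
      then show ?thesis
        by eventually_elim (auto simp: w_def u_def l1norm_eq_0_iff)
    qed
    have "AE q in lborel. 0 < q \<longrightarrow> (\<forall>k. U k q = 0)"
      by (rule vanishing_propagates[OF IE v q0 init, where \<alpha>=\<alpha>]) (use b00 in \<open>simp add: b0_def
          w_def us_def\<close>)
    then have "AE q in lborel. w q * u q = 0"
      by eventually_elim (auto simp: u_def l1norm_eq_0_iff)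
    then have "(\<integral>\<^sup>+q. w q * u q \<partial>lborel) = 0" by (subst nn_integral_0_iff_AE) auto
    then show ?thesis unfolding goal by simp
  qed
qed

end
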